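(* Let $n\ge 1$, let $\varepsilon>0$, and let $D\subset\mathbb C^n$ be a $C^{1+\varepsilon}$-smooth bounded domain. Then there is a constant $c>0$ such that for any $z,w\in D$, $$l_D(z,w)\le 1-c\,d_D(z)\,d_D(w).$$
   Context: $\mathbb D$ denotes the open unit disc in $\mathbb C$, and $\mathcal O(\mathbb D,D)$ is the set of holomorphic maps from $\mathbb D$ to $D$. A domain is a nonempty connected open set. The Lempert function of a domain $D\subset\mathbb C^n$ is $$l_D(z,w)=\inf\{\alpha\in[0,1):\exists\,\varphi\in\mathcal O(\mathbb D,D):\ \varphi(0)=z,\ \varphi(\alpha)=w\},\qquad z,w\in D.$$ $d_D(z)$ is the Euclidean distance from $z$ to $\partial D$. A bounded domain $D$ is $C^{1+\varepsilon}$-smooth if it has a real-valued defining function $r$ (so $D=\{r<0\}$ and $\partial D=\{r=0\}$) that is of class $C^1$ near $\partial D$, with nonvanishing gradient on $\partial D$ and with gradient Hölder continuous of exponent $\varepsilon$ near $\partial D$. *)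

theory Defs
  imports "HOL-Analysis.Analysis"
begin

text \<open>The space $\mathbb{C}^n$ is \<open>complex ^ 'n\<close>; its norm is the Euclidean one and its inner
  product is the real one of $\mathbb{R}^{2n}$.\<close>

definition hol_discs :: "(complex ^ 'n) set \<Rightarrow> (complex \<Rightarrow> complex ^ 'n) set" where
  "hol_discs D = {\<phi>. (\<forall>i. (\<lambda>\<zeta>. \<phi> \<zeta> $ i) holomorphic_on ball 0 1) \<and> \<phi> ` ball 0 1 \<subseteq> D}"

text \<open>The infimum is taken over a set that is nonempty for points of a domain, since any two points
  of a domain lie on a common holomorphic disc; so the unspecified real \<open>Inf {}\<close> plays no role.\<close>

definition lempert :: "(complex ^ 'n) set \<Rightarrow> complex ^ 'n \<Rightarrow> complex ^ 'n \<Rightarrow> real" where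
  "lempert D z w =
     Inf {\<alpha>::real. 0 \<le> \<alpha> \<and> \<alpha> < 1 \<and> (\<exists>\<phi>\<in>hol_discs D. \<phi> 0 = z \<and> \<phi> (of_real \<alpha>) = w)}"

definition bdist :: "'a::metric_space set \<Rightarrow> 'a \<Rightarrow> real" where
  "bdist D z = infdist z (frontier D)"

definition is_domain :: "'a::topological_space set \<Rightarrow> bool" where
  "is_domain D \<longleftrightarrow> open D \<and> connected D \<and> D \<noteq> {}"

definition hoelder_on ::
    "real \<Rightarrow> 'a::metric_space set \<Rightarrow> ('a \<Rightarrow> 'b::metric_space) \<Rightarrow> bool" where
  "hoelder_on e U g \<longleftrightarrow> (\<exists>C\<ge>0. \<forall>x\<in>U. \<forall>y\<in>U. dist (g x) (g y) \<le> C * dist x y powr e)"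

text \<open>The set \<open>U\<close> is the neighbourhood of the boundary meant by ``near $\partial D$'', and \<open>g\<close> is the
  gradient of the defining function \<open>r\<close> there. No regularity is required of \<open>r\<close> outside \<open>U\<close>.\<close>

definition C1_plus_smooth :: "real \<Rightarrow> 'a::euclidean_space set \<Rightarrow> bool" where
  "C1_plus_smooth e D \<longleftrightarrow>
     (\<exists>(r :: 'a \<Rightarrow> real) (g :: 'a \<Rightarrow> 'a) U.
        D = {z. r z < 0} \<and> frontier D = {z. r z = 0} \<and>
        open U \<and> frontier D \<subseteq> U \<and>
        (\<forall>z\<in>U. GDERIV r z :> g z) \<and> continuous_on U g \<and>
        (\<forall>z\<in>frontier D. g z \<noteq> 0) \<and>
        hoelder_on e U g)"

end

theory Submission
  imports Defs
begin

text \<open>It suffices to find, for \<open>z\<close> and \<open>w\<close> in \<open>D\<close>, a disc \<open>\<phi>\<close> in \<open>D\<close> and real points \<open>a\<close>, \<open>b\<close> with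
  \<open>\<phi> a = z\<close>, \<open>\<phi> b = w\<close> whose distances to the unit circle are at least constant multiples of the
  distances of \<open>z\<close>, \<open>w\<close> to the boundary of \<open>D\<close>. Such a disc is a composition \<open>P \<circ> H\<close>. The map \<open>H\<close> sends
  the disc into a thin neighbourhood of the segment from \<open>0\<close> to \<open>1\<close> which at both ends is contained in
  a cusp \<open>Re u \<ge> c * norm u powr (1 + e)\<close>; nevertheless a point at distance \<open>s\<close> from an end of the
  segment is the image of a real point at distance at least \<open>const * s\<close> from the circle. The map \<open>P\<close>
  follows on the segment a path in \<open>D\<close> which, if \<open>z\<close> and \<open>w\<close> are close to the boundary, joins the
  boundary points nearest to them and leaves both in the normal direction; it is a Bernstein
  polynomial of that path, with a small correction, at
  complex argument. By the Hoelder condition on the gradient, \<open>P\<close> maps the cusps into \<open>D\<close>. All constants are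
  uniform in \<open>z\<close> and \<open>w\<close> by compactness.\<close>

section \<open>Boundary germs\<close>

text \<open>For \<open>u \<bullet> v > 0\<close> the points \<open>p + t *\<^sub>R u\<close> with
  small \<open>t > 0\<close> lie in the ball that touches at \<open>p\<close>, so \<open>r\<close>
  cannot increase in the direction \<open>u\<close>. If \<open>g\<close> had a nonzero component
  orthogonal to \<open>v\<close>, that component, tilted slightly towards \<open>v\<close>, would be
  a direction of increase.\<close>

lemma gradient_inner_normal:
  fixes r :: "'a::real_inner \<Rightarrow> real"
  assumes der: "GDERIV r p :> g" and rp: "r p = 0" and d: "d > 0" and v: "norm v = 1"
    and sub: "ball (p + d *\<^sub>R v) d \<subseteq> {z. r z < 0}"
  shows "g = - norm g *\<^sub>R v"
proof -
  have vv: "v \<bullet> v = 1" using v by (simp add: dot_square_norm)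
  have main: "u \<bullet> g \<le> 0" if u: "u \<bullet> v > 0" for u
  proof (rule ccontr)
    assume "\<not> u \<bullet> g \<le> 0"
    have "((\<lambda>t. r (p + t *\<^sub>R u)) has_derivative (\<lambda>t. (t *\<^sub>R u) \<bullet> g)) (at 0)"
    proof (rule has_derivative_compose[where g=r and f="\<lambda>t. p + t *\<^sub>R u"])
      show "((\<lambda>t. p + t *\<^sub>R u) has_derivative (\<lambda>t. t *\<^sub>R u)) (at 0)"
        by (auto intro!: derivative_eq_intros)
    qed (use der in \<open>simp add: gderiv_def\<close>)
    then have "((\<lambda>t. r (p + t *\<^sub>R u)) has_real_derivative u \<bullet> g) (at 0)"
      by (simp add: has_field_derivative_def mult.commute mult_commute_abs)
    from DERIV_pos_inc_right[OF this] \<open>\<not> u \<bullet> g \<le> 0\<close>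
    obtain b where b: "b > 0" "\<And>h. 0 < h \<Longrightarrow> h < b \<Longrightarrow> r (p + h *\<^sub>R u) > 0"
      using rp by auto
    have un: "norm u > 0" using u by auto
    \<comment> \<open>The first bound keeps \<open>t\<close> where \<open>r\<close> is positive; the
      second puts the point into the ball, since its squared distance from the centre is
      \<open>d\<^sup>2 + t * (t * (norm u)\<^sup>2 - 2 * d * (u \<bullet> v))\<close>.\<close>
    define t where "t = min (b/2) (d * (u \<bullet> v) / (norm u)\<^sup>2)"
    have t0: "t > 0" using b d u un by (simp add: t_def)
    have "t * (norm u)\<^sup>2 \<le> d * (u \<bullet> v)"
      using un by (simp add: t_def min_def field_simps)
    then have t1: "t * (norm u)\<^sup>2 < 2 * d * (u \<bullet> v)"
      using mult_pos_pos[OF d u] by simp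
    have "(norm (t *\<^sub>R u - d *\<^sub>R v))\<^sup>2 = t * (t * (norm u)\<^sup>2 - 2 * d * (u \<bullet> v)) + d\<^sup>2"
      unfolding power2_norm_eq_inner using vv
      by (simp add: inner_diff_left inner_diff_right inner_commute[of v u] algebra_simps power2_eq_square)
    also have "\<dots> < d\<^sup>2" using t0 t1 by (simp add: mult_pos_neg)
    finally have "norm (t *\<^sub>R u - d *\<^sub>R v) < d"
      using d by (simp add: power2_less_imp_less)
    then have "p + t *\<^sub>R u \<in> ball (p + d *\<^sub>R v) d"
      by (simp add: dist_norm norm_minus_commute)
    then have "r (p + t *\<^sub>R u) < 0" using sub by blast
    moreover have "t < b" using b by (simp add: t_def)
    ultimately show False using b(2)[OF t0] by fastforce
  qed
  have le: "v \<bullet> g \<le> 0" using main[of v] v by (simp add: dot_square_norm)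
  have gv: "(norm g)\<^sup>2 \<le> (g \<bullet> v)\<^sup>2"
  proof (rule ccontr)
    assume "\<not> ?thesis"
    then have pos: "(norm g)\<^sup>2 - (g \<bullet> v)\<^sup>2 > 0" by simp
    \<comment> \<open>The test direction is the component of \<open>g\<close> orthogonal to
      \<open>v\<close>, plus \<open>s *\<^sub>R v\<close>. The denominator has
      \<open>1 - g \<bullet> v\<close> instead of \<open>- (g \<bullet> v)\<close> because the
      latter may be zero.\<close>
    define s where "s = ((norm g)\<^sup>2 - (g \<bullet> v)\<^sup>2) / (2 * (1 - g \<bullet> v))"
    have den: "1 - g \<bullet> v > 0" using le by (simp add: inner_commute)
    have s: "s > 0" using pos den by (simp add: s_def)
    have "(g + (s - g \<bullet> v) *\<^sub>R v) \<bullet> g \<le> 0"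
      by (rule main) (use s vv in \<open>simp add: inner_add_left\<close>)
    then have "(norm g)\<^sup>2 - (g \<bullet> v)\<^sup>2 \<le> s * (- (g \<bullet> v))"
      by (simp add: inner_add_left dot_square_norm inner_commute algebra_simps power2_eq_square)
    also have "\<dots> \<le> s * (1 - g \<bullet> v)" using s by (simp add: algebra_simps)
    also have "\<dots> = ((norm g)\<^sup>2 - (g \<bullet> v)\<^sup>2) / 2" using den by (simp add: s_def field_simps)
    finally show False using pos by simp
  qed
  have "(norm (g - (g \<bullet> v) *\<^sub>R v))\<^sup>2 = (norm g)\<^sup>2 - (g \<bullet> v)\<^sup>2"
    unfolding power2_norm_eq_inner using vv
    by (simp add: inner_diff_left inner_diff_right inner_commute[of v g] algebra_simps power2_eq_square)
  with gv have "(norm (g - (g \<bullet> v) *\<^sub>R v))\<^sup>2 \<le> 0" by simp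
  then have eq: "g = (g \<bullet> v) *\<^sub>R v" by simp
  then have "norm g = \<bar>g \<bullet> v\<bar>" using v by (metis norm_scaleR mult.right_neutral)
  then have "g \<bullet> v = - norm g" using le by (simp add: inner_commute)
  then show ?thesis using eq by simp
qed

lemma ball_bdist_subset:
  fixes z :: "'a::real_normed_vector"
  assumes "z \<in> D" shows "ball z (bdist D z) \<subseteq> D"
proof (rule ccontr)
  assume "\<not> ?thesis"
  then have ne: "ball z (bdist D z) - D \<noteq> {}" by auto
  then have "ball z (bdist D z) \<inter> D \<noteq> {}"
    by (metis assms ball_eq_empty centre_in_ball disjoint_iff empty_Diff not_le)
  then have "ball z (bdist D z) \<inter> frontier D \<noteq> {}"
    using connected_Int_frontier[of "ball z (bdist D z)" D] ne by blast
  then obtain y where "y \<in> frontier D" "dist z y < bdist D z" by auto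
  then show False using infdist_le[of y "frontier D" z] by (auto simp: bdist_def)
qed

text \<open>Here \<open>p\<close> is a boundary point nearest to \<open>z\<close>, and the ball
  around \<open>z\<close> through \<open>p\<close> identifies \<open>v\<close> as the inner normal.
  By the mean value theorem and the Hoelder bound, \<open>r y\<close> is at most
  \<open>- norm (g p) * ((y - p) \<bullet> v)\<close> plus a multiple of
  \<open>norm (y - p) powr (1 + e)\<close>. Compactness of the boundary makes the constants
  independent of \<open>z\<close>.\<close>

lemma boundary_layer:
  fixes D :: "'a::euclidean_space set"
  assumes e: "0 < e" "e \<le> \<epsilon>" and dom: "is_domain D" and bdd: "bounded D"
    and sm: "C1_plus_smooth \<epsilon> D"
  obtains \<rho> C where "\<rho> > 0" "C > 0"
    "\<And>z. z \<in> D \<Longrightarrow> bdist D z < \<rho> \<Longrightarrow> \<exists>p v. norm v = 1 \<and> z = p + bdist D z *\<^sub>R v \<and> p \<in> frontier D \<and>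
       bdist D z > 0 \<and>
       (\<forall>y. norm (y - p) < \<rho> \<longrightarrow> C * norm (y - p) powr (1 + e) < (y - p) \<bullet> v \<longrightarrow> y \<in> D)"
proof -
  obtain r g U where D: "D = {z. r z < 0}" and fr: "frontier D = {z. r z = 0}" and
    U: "open U" "frontier D \<subseteq> U" and der: "\<And>z. z \<in> U \<Longrightarrow> GDERIV r z :> g z" and
    cont: "continuous_on U g" and nz: "\<And>z. z \<in> frontier D \<Longrightarrow> g z \<noteq> 0" and ho: "hoelder_on \<epsilon> U g"
    using sm unfolding C1_plus_smooth_def by blast
  obtain H where H: "H \<ge> 0" "\<And>x y. x \<in> U \<Longrightarrow> y \<in> U \<Longrightarrow> dist (g x) (g y) \<le> H * dist x y powr \<epsilon>"
    using ho unfolding hoelder_on_def by blast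
  have opD: "open D" and neD: "D \<noteq> {}" using dom by (auto simp: is_domain_def)
  have cF: "compact (frontier D)" using bdd by blast
  have neF: "frontier D \<noteq> {}"
    using frontier_eq_empty[of D] neD bdd not_bounded_UNIV by blast
  have clU: "closed (- U)" using U(1) by auto
  have disj: "frontier D \<inter> - U = {}" using U(2) by auto
  obtain \<rho>1 where \<rho>1: "\<rho>1 > 0" "\<And>x y. x \<in> frontier D \<Longrightarrow> y \<in> - U \<Longrightarrow> \<rho>1 \<le> dist x y"
    using separate_compact_closed[OF cF clU disj] by blast
  have "continuous_on (frontier D) (\<lambda>z. norm (g z))"
    using cont U(2) by (intro continuous_on_norm) (rule continuous_on_subset)
  from continuous_attains_inf[OF cF neF this] obtain x0 where
    x0: "x0 \<in> frontier D" "\<And>y. y \<in> frontier D \<Longrightarrow> norm (g x0) \<le> norm (g y)" by blast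
  define m where "m = norm (g x0)"
  have m: "m > 0" using nz x0(1) by (simp add: m_def)
  \<comment> \<open>The bound \<open>\<rho>1\<close> keeps the segment from \<open>p\<close> to
    \<open>y\<close> in \<open>U\<close>; the bound 1 allows the exponent \<open>\<epsilon>\<close>
    to be lowered to \<open>e\<close>.\<close>
  define \<rho> where "\<rho> = min 1 \<rho>1"
  \<comment> \<open>\<open>H\<close> may be 0; the summand 1 keeps \<open>C\<close>
    positive.\<close>
  define C where "C = (H + 1) / m"
  show thesis
  proof
    show "\<rho> > 0" "C > 0" using \<rho>1 m H by (auto simp: \<rho>_def C_def)
    fix z assume z: "z \<in> D" "bdist D z < \<rho>"
    obtain p where p: "p \<in> frontier D" "bdist D z = dist z p"
      using infdist_attains_inf[OF compact_imp_closed[OF cF] neF] unfolding bdist_def by blast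
    define d where "d = bdist D z"
    have "z \<noteq> p" using z(1) p(1) opD fr D by auto
    then have d: "d > 0" using p(2) by (simp add: d_def)
    define v where "v = (1/d) *\<^sub>R (z - p)"
    have v: "norm v = 1" using d p(2) by (simp add: v_def d_def dist_norm)
    have zp: "z = p + d *\<^sub>R v" using d by (simp add: v_def)
    have pU: "p \<in> U" using p U by auto
    have gp: "g p = - norm (g p) *\<^sub>R v"
    proof (rule gradient_inner_normal[OF der[OF pU] _ d v])
      show "r p = 0" using p fr by auto
      show "ball (p + d *\<^sub>R v) d \<subseteq> {z. r z < 0}"
        using ball_bdist_subset[OF z(1)] D unfolding d_def[symmetric] zp[symmetric] by simp
    qed
    have mg: "m \<le> norm (g p)" using x0(2)[OF p(1)] by (simp add: m_def)
    have "y \<in> D" if y: "norm (y - p) < \<rho>" and cy: "C * norm (y - p) powr (1 + e) < (y - p) \<bullet> v" for y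
    proof -
      have seg: "x \<in> U" if "norm (x - p) \<le> norm (y - p)" for x
      proof (rule ccontr)
        assume "x \<notin> U"
        then have "\<rho>1 \<le> dist p x" using \<rho>1(2)[OF p(1)] by auto
        then show False using that y by (simp add: \<rho>_def dist_norm norm_minus_commute)
      qed
      define f where "f t = r (p + t *\<^sub>R (y - p))" for t
      have nt: "norm (t *\<^sub>R (y - p)) \<le> norm (y - p)" if "0 \<le> t" "t \<le> 1" for t
        using that by (simp add: mult_left_le_one_le)
      have fd: "(f has_derivative (\<lambda>h. (h *\<^sub>R (y - p)) \<bullet> g (p + t *\<^sub>R (y - p)))) (at t within {0..1})"
        if "0 \<le> t" "t \<le> 1" for t
      proof -
        have "p + t *\<^sub>R (y - p) \<in> U" using nt[OF that] by (intro seg) simp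
        from der[OF this] show ?thesis
          unfolding f_def gderiv_def
          by (rule has_derivative_compose[where g=r and f="\<lambda>t. p + t *\<^sub>R (y - p)", rotated])
            (auto intro!: derivative_eq_intros)
      qed
      \<comment> \<open>The gradient at the intermediate point is then compared with the gradient at
        \<open>p\<close>.\<close>
      from mvt_very_simple[of 0 1 f, OF _ fd] obtain t where t: "0 \<le> t" "t \<le> 1"
        and ft: "f 1 - f 0 = (y - p) \<bullet> g (p + t *\<^sub>R (y - p))" by auto
      define \<xi> where "\<xi> = p + t *\<^sub>R (y - p)"
      have \<xi>: "norm (\<xi> - p) \<le> norm (y - p)" using nt[OF t] by (simp add: \<xi>_def)
      have "r p = 0" using p fr by auto
      then have "r y = (y - p) \<bullet> g p + (y - p) \<bullet> (g \<xi> - g p)"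
        using ft by (simp add: f_def \<xi>_def inner_diff_right)
      also have "(y - p) \<bullet> g p = - norm (g p) * ((y - p) \<bullet> v)"
        by (subst gp) simp
      also have "(y - p) \<bullet> (g \<xi> - g p) \<le> norm (y - p) * norm (g \<xi> - g p)"
        by (rule norm_cauchy_schwarz)
      also have "norm (g \<xi> - g p) \<le> H * dist \<xi> p powr \<epsilon>"
        using H(2)[OF seg[OF \<xi>] pU] by (simp add: dist_norm)
      also have "\<dots> \<le> H * norm (y - p) powr \<epsilon>"
        using H \<xi> e by (intro mult_left_mono powr_mono2) (auto simp: dist_norm)
      also have "\<dots> \<le> H * norm (y - p) powr e"
        using H y e by (intro mult_left_mono powr_mono') (auto simp: \<rho>_def)
      also have "norm (y - p) * (H * norm (y - p) powr e) = H * norm (y - p) powr (1 + e)"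
        by (simp add: powr_add)
      finally have ry: "r y \<le> - norm (g p) * ((y - p) \<bullet> v) + H * norm (y - p) powr (1 + e)"
        by (simp add: mult_left_mono)
      have "H * norm (y - p) powr (1 + e) \<le> m * (C * norm (y - p) powr (1 + e))"
        using m by (simp add: C_def) (simp add: algebra_simps)
      also have "\<dots> < m * ((y - p) \<bullet> v)" using cy m by simp
      also have "\<dots> \<le> norm (g p) * ((y - p) \<bullet> v)"
      proof (rule mult_right_mono[OF mg])
        have "C * norm (y - p) powr (1 + e) \<ge> 0" using H m by (simp add: C_def)
        then show "0 \<le> (y - p) \<bullet> v" using cy by linarith
      qed
      finally show "y \<in> D" using ry D by simp
    qed
    then show "\<exists>p v. norm v = 1 \<and> z = p + bdist D z *\<^sub>R v \<and> p \<in> frontier D \<and> bdist D z > 0 \<and>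
       (\<forall>y. norm (y - p) < \<rho> \<longrightarrow> C * norm (y - p) powr (1 + e) < (y - p) \<bullet> v \<longrightarrow> y \<in> D)"
      using v zp p(1) d unfolding d_def by (intro exI[of _ p] exI[of _ v]) auto
  qed
qed

section \<open>Complex multiples in the real inner product space\<close>

lemma norm_vector_scalar_mult: "norm (c *s x) = norm c * norm x"
  for x :: "'a::real_normed_field ^ 'n"
  by (simp add: norm_vec_def L2_set_right_distrib norm_mult)

lemma inner_vector_scalar_mult_self: "(c *s x) \<bullet> x = Re c * (norm x)\<^sup>2"
  for x :: "complex ^ 'n"
proof -
  have "(c *s x) \<bullet> x = (\<Sum>i\<in>UNIV. Re c * (norm (x $ i))\<^sup>2)"
    unfolding inner_vec_def
    by (intro sum.cong) (simp_all add: inner_complex_def cmod_power2 vector_scalar_mult_def, simp add: algebra_simps power2_eq_square)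
  also have "\<dots> = Re c * (norm x)\<^sup>2"
    by (simp add: norm_vec_def L2_set_def sum_nonneg sum_distrib_left)
  finally show ?thesis .
qed

lemma of_real_vector_scalar_mult: "complex_of_real t *s x = t *\<^sub>R x"
  by (vector scaleR_conv_of_real)

text \<open>Rescaling by \<open>\<rho>\<close> multiplies the constant of the boundary layer by \<open>\<rho> powr e\<close>, so \<open>c\<close> may be
  prescribed. A point far from the boundary gets a vector \<open>V\<close> so short that the condition holds
  within a ball around it.\<close>

lemma boundary_germ:
  fixes D :: "(complex ^ 'n) set"
  assumes e: "0 < e" "e \<le> 1" "e \<le> \<epsilon>" and dom: "is_domain D" and bdd: "bounded D"
    and sm: "C1_plus_smooth \<epsilon> D" and c: "c > 0" and s0: "0 < s0" "s0 \<le> 1"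
  obtains \<kappa> \<kappa>' R where "\<kappa> > 0" "\<kappa>' > 0"
    "\<And>z. z \<in> D \<Longrightarrow> \<exists>p V s. z = p + s *\<^sub>R V \<and> 0 < s \<and> s \<le> s0 \<and> \<kappa>' * bdist D z \<le> s \<and>
       norm p \<le> R \<and> norm V \<le> R \<and>
       (\<forall>u q. norm u \<le> 1 \<longrightarrow> norm q + c * \<kappa> * norm u powr (1 + e) < \<kappa> * Re u \<longrightarrow> p + u *s V + q \<in> D)"
proof -
  obtain \<rho>0 C where \<rho>0: "\<rho>0 > 0" and C: "C > 0" and
    layer: "\<And>z. z \<in> D \<Longrightarrow> bdist D z < \<rho>0 \<Longrightarrow> \<exists>p v. norm v = 1 \<and> z = p + bdist D z *\<^sub>R v \<and> p \<in> frontier D \<and>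
       bdist D z > 0 \<and>
       (\<forall>y. norm (y - p) < \<rho>0 \<longrightarrow> C * norm (y - p) powr (1 + e) < (y - p) \<bullet> v \<longrightarrow> y \<in> D)"
    using boundary_layer[OF e(1) e(3) dom bdd sm] by blast
  \<comment> \<open>The displacement \<open>u *s (\<rho> *\<^sub>R v) + q\<close> will have norm at
    most \<open>2 * \<rho> * norm u\<close>. The first bound keeps it inside the layer; the second
    gives \<open>4 * C * \<rho> powr e \<le> c\<close>, where 4 bounds
    \<open>2 powr (1 + e)\<close>.\<close>
  define \<rho> where "\<rho> = min (\<rho>0 / 4) ((c / (4 * C)) powr (1 / e))"
  have \<rho>: "\<rho> > 0" "2 * \<rho> < \<rho>0" using \<rho>0 C c e by (auto simp: \<rho>_def)
  have "\<rho> powr e \<le> ((c / (4 * C)) powr (1 / e)) powr e"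
    using \<rho> e by (intro powr_mono2) (auto simp: \<rho>_def)
  also have "\<dots> = c / (4 * C)" using C c e by (simp add: powr_powr)
  finally have "\<rho> powr e \<le> c / (4 * C)" .
  then have "4 * (C * \<rho> powr e) \<le> c" using C by (simp add: field_simps)
  moreover have "(2::real) powr (1 + e) \<le> 2 powr 2" using e by (intro powr_mono) auto
  then have "2 powr (1 + e) * (C * \<rho> powr e) \<le> 4 * (C * \<rho> powr e)"
    using C by (intro mult_right_mono) auto
  ultimately have "2 powr (1 + e) * (C * \<rho> powr e) * \<rho> \<le> c * \<rho>"
    using \<rho> by (intro mult_right_mono) auto
  then have C\<rho>: "C * (2 * \<rho>) powr (1 + e) \<le> c * \<rho>"
    using \<rho> by (simp add: powr_mult powr_add mult_ac)
  have "bounded (closure D)" using bdd by (rule bounded_closure)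
  then obtain R0 where R0: "R0 > 0" "\<And>x. x \<in> closure D \<Longrightarrow> norm x \<le> R0"
    by (auto simp: bounded_pos)
  obtain x0 where x0: "x0 \<in> frontier D"
    using frontier_eq_empty[of D] dom bdd not_bounded_UNIV unfolding is_domain_def by blast
  have frc: "frontier D \<subseteq> closure D" by (auto simp: frontier_def)
  have bd: "bdist D z \<le> 2 * R0" if "z \<in> D" for z
  proof -
    have "bdist D z \<le> dist z x0" unfolding bdist_def using x0 by (rule infdist_le)
    also have "\<dots> \<le> norm z + norm x0" by (simp add: dist_norm norm_triangle_ineq4)
    also have "\<dots> \<le> 2 * R0"
      using R0(2)[OF subsetD[OF closure_subset that]] R0(2)[OF subsetD[OF frc x0]] by simp
    finally show ?thesis .
  qed
  \<comment> \<open>\<open>\<kappa> \<le> \<rho>\<close> is used near the boundary. Far from it,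
    three displacements of length at most \<open>\<kappa>\<close> must fit into a ball of radius
    \<open>s0 * \<rho>\<close>.\<close>
  define \<kappa> where "\<kappa> = s0 * \<rho> / 8"
  have \<kappa>: "\<kappa> > 0" "\<kappa> \<le> \<rho>" "3 * \<kappa> < s0 * \<rho>" using s0 \<rho> by (auto simp: \<kappa>_def mult_left_le_one_le)
  \<comment> \<open>The first bound serves the points near the boundary, where \<open>s\<close> is
    \<open>bdist D z / \<rho>\<close>; the second serves the others, where \<open>s = s0\<close> and
    the distance is at most \<open>2 * R0\<close>.\<close>
  define \<kappa>' where "\<kappa>' = min (1 / \<rho>) (s0 / (2 * R0))"
  show thesis
  proof
    show "\<kappa> > 0" "\<kappa>' > 0" using \<kappa> s0 \<rho> R0 by (auto simp: \<kappa>'_def)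
    fix z assume z: "z \<in> D"
    have q\<kappa>: "norm q < \<kappa> * norm u \<and> norm q < \<kappa> * (Re u - c * norm u powr (1 + e))"
      if "norm q + c * \<kappa> * norm u powr (1 + e) < \<kappa> * Re u" for q :: "complex ^ 'n" and u
    proof -
      have "0 \<le> c * \<kappa> * norm u powr (1 + e)" using c \<kappa> by simp
      moreover have "\<kappa> * Re u \<le> \<kappa> * norm u" using \<kappa> complex_Re_le_cmod[of u] by simp
      moreover have "\<kappa> * (Re u - c * norm u powr (1 + e)) = \<kappa> * Re u - c * \<kappa> * norm u powr (1 + e)"
        by (simp add: algebra_simps)
      ultimately show ?thesis using that by linarith
    qed
    show "\<exists>p V s. z = p + s *\<^sub>R V \<and> 0 < s \<and> s \<le> s0 \<and> \<kappa>' * bdist D z \<le> s \<and>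
       norm p \<le> R0 + \<rho> \<and> norm V \<le> R0 + \<rho> \<and>
       (\<forall>u q. norm u \<le> 1 \<longrightarrow> norm q + c * \<kappa> * norm u powr (1 + e) < \<kappa> * Re u \<longrightarrow> p + u *s V + q \<in> D)"
    \<comment> \<open>This threshold is what makes \<open>s = bdist D z / \<rho>\<close> at most
      \<open>s0\<close>.\<close>
    proof (cases "bdist D z < s0 * \<rho>")
      case True
      have "s0 * \<rho> \<le> \<rho>" using s0 \<rho> by (simp add: mult_left_le_one_le)
      then have "bdist D z < \<rho>0" using True \<rho> by linarith
      then obtain p v where v: "norm v = 1" and zp: "z = p + bdist D z *\<^sub>R v" and p: "p \<in> frontier D"
        and d: "bdist D z > 0"
        and inD: "\<And>y. norm (y - p) < \<rho>0 \<Longrightarrow> C * norm (y - p) powr (1 + e) < (y - p) \<bullet> v \<Longrightarrow> y \<in> D"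
        using layer[OF z] by blast
      have germ: "p + u *s (\<rho> *\<^sub>R v) + q \<in> D"
        if u: "norm u \<le> 1" and q: "norm q + c * \<kappa> * norm u powr (1 + e) < \<kappa> * Re u" for u q
      proof (rule inD)
        let ?w = "p + u *s (\<rho> *\<^sub>R v) + q - p"
        have nV: "norm (u *s (\<rho> *\<^sub>R v)) = \<rho> * norm u"
          using \<rho> v by (simp add: norm_vector_scalar_mult)
        have "norm q \<le> \<rho> * norm u"
          using q\<kappa>[OF q] mult_right_mono[OF \<kappa>(2), of "norm u"] by simp
        then have w: "norm ?w \<le> 2 * \<rho> * norm u"
          using norm_triangle_ineq[of "u *s (\<rho> *\<^sub>R v)" q] nV by simp
        also have "\<dots> \<le> 2 * \<rho>" using u \<rho> by (simp add: mult_left_le)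
        finally show "norm ?w < \<rho>0" using \<rho> by linarith
        have "norm ?w powr (1 + e) \<le> (2 * \<rho> * norm u) powr (1 + e)"
          using w e by (intro powr_mono2) auto
        then have "C * norm ?w powr (1 + e) \<le> C * (2 * \<rho>) powr (1 + e) * norm u powr (1 + e)"
          using C \<rho> by (simp add: powr_mult mult.assoc)
        also have "\<dots> \<le> c * \<rho> * norm u powr (1 + e)"
          using C\<rho> by (intro mult_right_mono) auto
        also have "\<dots> < \<rho> * Re u - norm q"
        proof -
          have "norm q < \<kappa> * (Re u - c * norm u powr (1 + e))" using q\<kappa>[OF q] by simp
          moreover from this have "0 < \<kappa> * (Re u - c * norm u powr (1 + e))"
            using norm_ge_zero[of q] by linarith
          \<comment> \<open>Positivity of this factor allows \<open>\<kappa>\<close> to be replaced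
            by the larger \<open>\<rho>\<close>.\<close>
          then have "0 < Re u - c * norm u powr (1 + e)" using \<kappa>(1) zero_less_mult_pos by blast
          then have "\<kappa> * (Re u - c * norm u powr (1 + e)) \<le> \<rho> * (Re u - c * norm u powr (1 + e))"
            using \<kappa>(2) by (intro mult_right_mono) auto
          ultimately show ?thesis by (simp add: algebra_simps)
        qed
        also have "\<dots> \<le> ?w \<bullet> v"
        proof -
          have "(u *s (\<rho> *\<^sub>R v)) \<bullet> (\<rho> *\<^sub>R v) = Re u * (norm (\<rho> *\<^sub>R v))\<^sup>2"
            by (rule inner_vector_scalar_mult_self)
          then have "\<rho> * ((u *s (\<rho> *\<^sub>R v)) \<bullet> v) = \<rho> * (\<rho> * Re u)"
            using v \<rho> by (simp add: power2_eq_square)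
          then have "(u *s (\<rho> *\<^sub>R v)) \<bullet> v = \<rho> * Re u" using \<rho> by (metis less_irrefl mult_left_cancel)
          moreover have "- norm q \<le> q \<bullet> v" using Cauchy_Schwarz_ineq2[of q v] v by simp
          ultimately show ?thesis by (simp add: inner_add_left)
        qed
        finally show "C * norm ?w powr (1 + e) < ?w \<bullet> v" .
      qed
      show ?thesis
      proof (intro exI conjI)
        show "z = p + (bdist D z / \<rho>) *\<^sub>R (\<rho> *\<^sub>R v)" using zp \<rho> by simp
        show "0 < bdist D z / \<rho>" "bdist D z / \<rho> \<le> s0" using True d \<rho> by (auto simp: field_simps)
        have "\<kappa>' \<le> 1 / \<rho>" by (simp add: \<kappa>'_def)
        then have "\<kappa>' * bdist D z \<le> (1 / \<rho>) * bdist D z"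
          using d by (intro mult_right_mono) auto
        then show "\<kappa>' * bdist D z \<le> bdist D z / \<rho>" by simp
        show "norm p \<le> R0 + \<rho>" using R0(2)[OF subsetD[OF frc p]] \<rho> by simp
        show "norm (\<rho> *\<^sub>R v) \<le> R0 + \<rho>" using v \<rho> R0(1) by simp
      qed (use germ in blast)
    next
      case False
      \<comment> \<open>The direction of \<open>V\<close> does not matter here; the base point is
        moved back to \<open>z - s0 *\<^sub>R V\<close> so that the parameter of \<open>z\<close> is
        \<open>s0\<close>.\<close>
      obtain V :: "complex ^ 'n" where V: "norm V = \<kappa>"
        using vector_choose_size[of \<kappa>] \<kappa>(1) by (meson less_imp_le)
      have germ: "z - s0 *\<^sub>R V + u *s V + q \<in> D"
        if u: "norm u \<le> 1" and q: "norm q + c * \<kappa> * norm u powr (1 + e) < \<kappa> * Re u" for u q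
      proof -
        let ?y = "z - s0 *\<^sub>R V + u *s V + q"
        have "?y - z = (u *s V - s0 *\<^sub>R V) + q" by simp
        then have "norm (?y - z) \<le> norm (u *s V) + norm (s0 *\<^sub>R V) + norm q"
          by (metis (no_types, opaque_lifting) add_right_mono norm_triangle_ineq norm_triangle_ineq4 order_trans)
        also have "\<dots> \<le> \<kappa> + \<kappa> + \<kappa>"
        proof (intro add_mono)
          show "norm (u *s V) \<le> \<kappa>" using u V \<kappa> by (simp add: norm_vector_scalar_mult mult_left_le_one_le)
          show "norm (s0 *\<^sub>R V) \<le> \<kappa>" using s0 V \<kappa> by (simp add: mult_left_le_one_le)
          have "\<kappa> * norm u \<le> \<kappa>" using u \<kappa> by (simp add: mult_left_le)
          then show "norm q \<le> \<kappa>" using q\<kappa>[OF q] by linarith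
        qed
        finally have "norm (?y - z) < bdist D z" using False \<kappa>(3) by linarith
        then have "?y \<in> ball z (bdist D z)" by (simp only: mem_ball dist_norm norm_minus_commute[of z ?y])
        then show ?thesis using ball_bdist_subset[OF z] by blast
      qed
      show ?thesis
      proof (intro exI conjI)
        show "z = (z - s0 *\<^sub>R V) + s0 *\<^sub>R V" by simp
        show "0 < s0" "s0 \<le> s0" using s0 by auto
        have "\<kappa>' * bdist D z \<le> (s0 / (2 * R0)) * (2 * R0)"
          using bd[OF z] s0 R0 by (intro mult_mono) (auto simp: \<kappa>'_def bdist_def infdist_nonneg)
        then show "\<kappa>' * bdist D z \<le> s0" using R0 by simp
        have "norm z \<le> R0" using R0(2)[OF subsetD[OF closure_subset z]] .
        moreover have "norm (s0 *\<^sub>R V) \<le> \<rho>" using s0 V \<kappa> \<rho>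
          by (simp add: mult_left_le_one_le) (metis mult_left_le_one_le order_trans less_imp_le)
        ultimately show "norm (z - s0 *\<^sub>R V) \<le> R0 + \<rho>"
          using norm_triangle_ineq4[of z "s0 *\<^sub>R V"] by linarith
        show "norm V \<le> R0 + \<rho>" using V \<kappa> R0(1) by simp
      qed (use germ in blast)
    qed
  qed
qed

section \<open>Uniformly Lipschitz paths\<close>

lemma polynomial_function_lipschitz_on:
  fixes g :: "real \<Rightarrow> 'a::euclidean_space"
  assumes "polynomial_function g"
  obtains L where "L-lipschitz_on {0..1} g"
proof -
  obtain g' where g': "polynomial_function g'" "\<And>x. (g has_vector_derivative g' x) (at x)"
    using has_vector_derivative_polynomial_function[OF assms] by blast
  have "compact (g' ` {0..1})"
    by (intro compact_continuous_image continuous_on_polymonial_function g'(1)) auto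
  then obtain B where B: "B > 0" "\<And>x. x \<in> {0..1} \<Longrightarrow> norm (g' x) \<le> B"
    using compact_imp_bounded bounded_pos by (metis imageI)
  have "B-lipschitz_on {0..1} g"
  proof (rule bounded_derivative_imp_lipschitz)
    show "(g has_derivative (\<lambda>h. h *\<^sub>R g' x)) (at x within {0..1})" for x
      using g'(2)[of x] unfolding has_vector_derivative_def
      by (rule has_derivative_at_withinI)
    show "onorm (\<lambda>h. h *\<^sub>R g' x) \<le> B" if "x \<in> {0..1}" for x
      using B(2)[OF that] by (intro onorm_le) (simp add: mult.commute[of B] mult_left_mono)
  qed (use B in auto)
  then show thesis by (rule that)
qed

text \<open>The admissible end points form a compact set \<open>K\<close>. A polynomial path between
  two points of \<open>D\<close> can be adjusted to all nearby pairs of end points with common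
  constants, and finitely many such neighbourhoods cover \<open>K \<times> K\<close>.\<close>

lemma lipschitz_paths:
  fixes D :: "'a::euclidean_space set"
  assumes opD: "open D" and conn: "connected D" and bdd: "bounded D" and \<kappa>: "\<kappa> > 0"
  obtains L \<delta> where "\<delta> > 0"
    "\<forall>q q'. ball q \<kappa> \<subseteq> D \<longrightarrow> ball q' \<kappa> \<subseteq> D \<longrightarrow>
      (\<exists>G :: real \<Rightarrow> 'a. L-lipschitz_on {0..1} G \<and> G 0 = q \<and> G 1 = q' \<and> (\<forall>x\<in>{0..1}. ball (G x) \<delta> \<subseteq> D))"
proof -
  define good where "good L \<delta> q q' \<longleftrightarrow>
    (\<exists>G. L-lipschitz_on {0..1} G \<and> G 0 = q \<and> G 1 = q' \<and> (\<forall>x\<in>{0..1::real}. ball (G x) \<delta> \<subseteq> D))"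
    for L \<delta> q q'
  define K where "K = {q. ball q \<kappa> \<subseteq> D}"
  have KD: "K \<subseteq> D" using \<kappa> by (force simp: K_def)
  have "K = (\<Inter>w\<in>-D. {q. \<kappa> \<le> dist q w})"
    unfolding K_def subset_eq not_less[symmetric] by auto
  moreover have "closed {q. \<kappa> \<le> dist q w}" for w :: 'a
    by (intro closed_Collect_le continuous_intros)
  ultimately have "closed K" by (metis (no_types, lifting) closed_INT)
  then have "compact K" using bdd KD by (metis bounded_subset compact_eq_bounded_closed)
  then have cK: "compact (K \<times> K)" by (intro compact_Times)
  have loc: "\<exists>r L \<delta>. r > 0 \<and> \<delta> > 0 \<and> (\<forall>q\<in>ball a r. \<forall>q'\<in>ball b r. good L \<delta> q q')"
    if ab: "a \<in> D" "b \<in> D" for a b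
  proof -
    obtain g where g: "polynomial_function g" "path_image g \<subseteq> D" "pathstart g = a" "pathfinish g = b"
      using connected_open_polynomial_connected[OF opD conn ab] by blast
    obtain L where L: "L-lipschitz_on {0..1} g" using polynomial_function_lipschitz_on[OF g(1)] .
    have cg: "compact (path_image g)"
      using g(1) by (simp add: compact_path_image path_polynomial_function)
    have cl: "closed (- D)" and dj: "path_image g \<inter> - D = {}" using opD g(2) by auto
    obtain \<delta> where \<delta>: "\<delta> > 0" "\<And>x y. x \<in> path_image g \<Longrightarrow> y \<in> - D \<Longrightarrow> \<delta> \<le> dist x y"
      using separate_compact_closed[OF cg cl dj] by blast
    have "good (L + \<delta>) (\<delta> / 2) q q'" if q: "q \<in> ball a (\<delta> / 2)" "q' \<in> ball b (\<delta> / 2)" for q q'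
      unfolding good_def
    proof (intro exI conjI ballI)
      \<comment> \<open>The affine correction moves the end points to \<open>q\<close> and
        \<open>q'\<close>. It has norm at most \<open>\<delta> / 2\<close> and slope at most
        \<open>\<delta>\<close>, so half of the clearance survives.\<close>
      let ?G = "\<lambda>x. g x + ((1 - x) *\<^sub>R (q - a) + x *\<^sub>R (q' - b))"
      have nq: "norm (q - a) < \<delta> / 2" "norm (q' - b) < \<delta> / 2"
        using q by (auto simp: dist_norm norm_minus_commute)
      show "?G 0 = q" "?G 1 = q'" using g by (auto simp: pathstart_def pathfinish_def)
      show "(L + \<delta>)-lipschitz_on {0..1} ?G"
      proof (rule lipschitz_onI)
        fix x y :: real assume xy: "x \<in> {0..1}" "y \<in> {0..1}"
        have "?G x - ?G y = (g x - g y) + (x - y) *\<^sub>R ((q' - b) - (q - a))"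
          by (simp add: algebra_simps)
        then have "norm (?G x - ?G y) \<le> norm (g x - g y) + \<bar>x - y\<bar> * norm ((q' - b) - (q - a))"
          by (metis norm_triangle_ineq norm_scaleR)
        also have "\<dots> \<le> L * \<bar>x - y\<bar> + \<bar>x - y\<bar> * \<delta>"
          using lipschitz_on_normD[OF L xy] nq norm_triangle_ineq4[of "q' - b" "q - a"]
          by (intro add_mono mult_left_mono) auto
        finally show "dist (?G x) (?G y) \<le> (L + \<delta>) * dist x y"
          by (simp add: dist_norm algebra_simps)
      qed (use lipschitz_on_nonneg[OF L] \<delta> in auto)
      fix x :: real assume x: "x \<in> {0..1}"
      have "norm ((1 - x) *\<^sub>R (q - a) + x *\<^sub>R (q' - b)) \<le> (1 - x) * norm (q - a) + x * norm (q' - b)"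
        using x by (intro norm_triangle_le) simp
      also have "\<dots> \<le> (1 - x) * (\<delta> / 2) + x * (\<delta> / 2)"
        using x nq by (intro add_mono mult_left_mono) auto
      also have "\<dots> = \<delta> / 2" by (simp add: field_simps)
      finally have "norm ((1 - x) *\<^sub>R (q - a) + x *\<^sub>R (q' - b)) \<le> \<delta> / 2" .
      moreover have "dist v (v + w) = norm w" for v w :: 'a by (simp add: dist_norm)
      ultimately have n: "dist (g x) (?G x) \<le> \<delta> / 2" by metis
      show "ball (?G x) (\<delta> / 2) \<subseteq> D"
      proof (rule subsetI, rule ccontr)
        fix y assume y: "y \<in> ball (?G x) (\<delta> / 2)" "y \<notin> D"
        have "\<delta> \<le> dist (g x) y" using \<delta>(2)[of "g x" y] x y by (auto simp: path_image_def)
        then show False using n y(1) dist_triangle[of "g x" y "?G x"] unfolding mem_ball by linarith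
      qed
    qed
    then show ?thesis using \<delta> by (meson half_gt_zero)
  qed
  then obtain r L \<delta> where r: "\<And>a b. a \<in> D \<Longrightarrow> b \<in> D \<Longrightarrow> r a b > 0 \<and> \<delta> a b > 0 \<and>
      (\<forall>q\<in>ball a (r a b). \<forall>q'\<in>ball b (r a b). good (L a b) (\<delta> a b) q q')"
    by metis
  define N where "N ab = ball (fst ab) (r (fst ab) (snd ab)) \<times> ball (snd ab) (r (fst ab) (snd ab))" for ab
  obtain C where C: "C \<subseteq> K \<times> K" "finite C" "K \<times> K \<subseteq> (\<Union>c\<in>C. N c)"
  proof (rule compactE_image[OF cK, of "K \<times> K" N])
    show "open (N c)" if "c \<in> K \<times> K" for c by (auto simp: N_def intro!: open_Times)
    show "K \<times> K \<subseteq> (\<Union>c\<in>K \<times> K. N c)"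
    proof
      fix c assume c: "c \<in> K \<times> K"
      then have "fst c \<in> D" "snd c \<in> D" using KD by (auto simp: mem_Times_iff)
      then have "r (fst c) (snd c) > 0" using r by blast
      then show "c \<in> (\<Union>c\<in>K \<times> K. N c)" by (intro UN_I[OF c]) (auto simp: N_def mem_Times_iff)
    qed
  qed blast
  \<comment> \<open>The inserted 0, and 1 in the minimum below, cover the case that \<open>C\<close>
    is empty.\<close>
  define L0 where "L0 = Max (insert 0 ((\<lambda>c. L (fst c) (snd c)) ` C))"
  define \<delta>0 where "\<delta>0 = Min (insert 1 ((\<lambda>c. \<delta> (fst c) (snd c)) ` C))"
  have 1: "\<delta>0 > 0" using C r KD by (force simp: \<delta>0_def)
  have 2: "\<exists>G :: real \<Rightarrow> 'a. L0-lipschitz_on {0..1} G \<and> G 0 = q \<and> G 1 = q' \<and> (\<forall>x\<in>{0..1}. ball (G x) \<delta>0 \<subseteq> D)"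
    if "ball q \<kappa> \<subseteq> D" "ball q' \<kappa> \<subseteq> D" for q q'
  proof -
    have "(q, q') \<in> K \<times> K" using that by (auto simp: K_def)
    then obtain c where c: "c \<in> C" "(q, q') \<in> N c" using C by blast
    have "c \<in> K \<times> K" using c(1) C(1) by blast
    then have "fst c \<in> D" "snd c \<in> D" using KD by (auto simp: mem_Times_iff)
    then have "good (L (fst c) (snd c)) (\<delta> (fst c) (snd c)) q q'"
      using r c(2) unfolding N_def by auto
    then obtain G :: "real \<Rightarrow> 'a" where G: "(L (fst c) (snd c))-lipschitz_on {0..1} G" "G 0 = q" "G 1 = q'"
        "\<And>x. x \<in> {0..1} \<Longrightarrow> ball (G x) (\<delta> (fst c) (snd c)) \<subseteq> D"
      unfolding good_def by blast
    have "L (fst c) (snd c) \<le> L0" using c C by (simp add: L0_def)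
    then have "L0-lipschitz_on {0..1} G" using G(1) lipschitz_on_le by blast
    moreover have "\<delta>0 \<le> \<delta> (fst c) (snd c)" using c C by (simp add: \<delta>0_def)
    then have "ball (G x) \<delta>0 \<subseteq> D" if "x \<in> {0..1}" for x
      using G(4)[OF that] subset_ball by blast
    ultimately show ?thesis
      using G(2,3) by blast
  qed
  show thesis using 1 2 by (intro that[of \<delta>0 L0]) blast+
qed

section \<open>Polynomial paths of complex argument\<close>

text \<open>The extension of the polynomial \<open>Bernstein N k\<close> to complex
  argument.\<close>

definition bernstein_weight :: "nat \<Rightarrow> nat \<Rightarrow> complex \<Rightarrow> complex" where
  "bernstein_weight N k u = of_nat (N choose k) * u ^ k * (1 - u) ^ (N - k)"

definition bernstein_sum :: "nat \<Rightarrow> (real \<Rightarrow> complex ^ 'n) \<Rightarrow> complex \<Rightarrow> complex ^ 'n" where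
  "bernstein_sum N f u = (\<Sum>k\<le>N. bernstein_weight N k u *s f (k / N))"

section \<open>Identities for the complex Bernstein weights\<close>

lemma sum_bernstein_weight: "(\<Sum>k\<le>N. bernstein_weight N k u) = 1"
  using binomial_ring[of u "1 - u" N] by (simp add: bernstein_weight_def)

text \<open>Together with \<open>sum_bernstein_weight\<close> it shows that Bernstein sums reproduce
  affine functions at complex arguments too.\<close>

lemma sum_k_bernstein_weight: "(\<Sum>k\<le>N. of_nat k * bernstein_weight N k u) = of_nat N * u"
proof (cases N)
  case (Suc M)
  have "(\<Sum>k\<le>Suc M. of_nat k * bernstein_weight (Suc M) k u) =
      (\<Sum>k\<le>M. of_nat (Suc k) * bernstein_weight (Suc M) (Suc k) u)"
    by (subst sum.atMost_Suc_shift) simp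
  also have "\<dots> = (\<Sum>k\<le>M. of_nat (Suc M) * u * bernstein_weight M k u)"
  proof (rule sum.cong[OF refl])
    fix k
    have c: "of_nat (Suc k) * of_nat (Suc M choose Suc k) = (of_nat (Suc M) * of_nat (M choose k) :: complex)"
      by (metis of_nat_mult Suc_times_binomial_eq mult.commute)
    have "of_nat (Suc k) * bernstein_weight (Suc M) (Suc k) u =
        (of_nat (Suc k) * of_nat (Suc M choose Suc k)) * (u * u ^ k * (1 - u) ^ (M - k))"
      unfolding bernstein_weight_def by (simp only: diff_Suc_Suc power_Suc mult.assoc)
    also have "\<dots> = of_nat (Suc M) * u * bernstein_weight M k u"
      unfolding c bernstein_weight_def by (simp add: mult_ac del: of_nat_Suc)
    finally show "of_nat (Suc k) * bernstein_weight (Suc M) (Suc k) u =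
        of_nat (Suc M) * u * bernstein_weight M k u" .
  qed
  also have "\<dots> = of_nat (Suc M) * u"
    by (simp add: sum_bernstein_weight flip: sum_distrib_left)
  finally show ?thesis using Suc by simp
qed simp

lemma bernstein_weight_of_real:
  "bernstein_weight N k (complex_of_real x) = complex_of_real (Bernstein N k x)"
  by (simp add: bernstein_weight_def Bernstein_def)

text \<open>This reduces estimates near 1 to estimates near 0. For \<open>N = 0\<close> the only
  node is \<open>0 / 0 = 0\<close>, which is not symmetric under reflection.\<close>

lemma bernstein_sum_reflect:
  assumes "N > 0" shows "bernstein_sum N f (1 - u) = bernstein_sum N (\<lambda>y. f (1 - y)) u"
proof -
  have "bernstein_sum N f (1 - u) =
      (\<Sum>k\<le>N. bernstein_weight N (N - k) (1 - u) *s f (real (N - k) / N))"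
    unfolding bernstein_sum_def
    by (rule sum.reindex_bij_witness[of _ "\<lambda>k. N - k" "\<lambda>k. N - k"]) auto
  also have "\<dots> = bernstein_sum N (\<lambda>y. f (1 - y)) u"
    unfolding bernstein_sum_def
  proof (rule sum.cong[OF refl])
    fix k assume k: "k \<in> {..N}"
    then have "bernstein_weight N (N - k) (1 - u) = bernstein_weight N k u"
      by (simp add: bernstein_weight_def binomial_symmetric[symmetric])
    moreover have "real (N - k) / N = 1 - k / N" using k assms by (simp add: of_nat_diff diff_divide_distrib)
    ultimately show "bernstein_weight N (N - k) (1 - u) *s f (real (N - k) / N) =
        bernstein_weight N k u *s f (1 - k / N)" by simp
  qed
  finally show ?thesis .
qed

lemma sum_vector_scalar_mult_left: "(\<Sum>k\<in>A. c k) *s x = (\<Sum>k\<in>A. c k *s x)"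
  for x :: "complex ^ 'n"
  by (induction A rule: infinite_finite_induct) (auto simp: vector_sadd_rdistrib)

text \<open>The error is at most \<open>L\<close> times the mean distance of \<open>k / N\<close>
  from \<open>x\<close> under the binomial weights, whose variance is
  \<open>x * (1 - x) / N\<close>. The Cauchy-Schwarz step takes the form of the inequality
  \<open>2 * t \<le> a + t\<^sup>2 / a\<close> with \<open>a = 1 / sqrt N\<close>.\<close>

lemma bernstein_sum_lipschitz_approx:
  fixes f :: "real \<Rightarrow> complex ^ 'n"
  assumes f: "L-lipschitz_on {0..1} f" and x: "x \<in> {0..1}" and N: "N > 0"
  shows "norm (bernstein_sum N f (of_real x) - f x) \<le> L / sqrt N"
proof -
  let ?B = "\<lambda>k. Bernstein N k x"
  have B0: "?B k \<ge> 0" for k using x Bernstein_nonneg by auto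
  have L: "L \<ge> 0" using f by (rule lipschitz_on_nonneg)
  have eq: "bernstein_sum N f (of_real x) - f x = (\<Sum>k\<le>N. ?B k *\<^sub>R (f (k / N) - f x))"
  proof -
    have "f x = (\<Sum>k\<le>N. ?B k *\<^sub>R f x)" by (simp flip: scaleR_sum_left)
    then show ?thesis
      unfolding bernstein_sum_def bernstein_weight_of_real of_real_vector_scalar_mult
      by (simp add: scaleR_diff_right sum_subtractf)
  qed
  define a where "a = 1 / sqrt N"
  have a: "a > 0" "a * a = 1 / N" using N by (auto simp: a_def)
  have "norm (bernstein_sum N f (of_real x) - f x) \<le> (\<Sum>k\<le>N. ?B k * (L * \<bar>k / N - x\<bar>))"
    unfolding eq
  proof (rule sum_norm_le)
    fix k assume "k \<in> {..N}"
    then have "real k / N \<in> {0..1}" using N by simp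
    from lipschitz_on_normD[OF f this x] B0[of k]
    show "norm (?B k *\<^sub>R (f (k / N) - f x)) \<le> ?B k * (L * \<bar>k / N - x\<bar>)"
      by (simp add: mult_left_mono)
  qed
  also have "\<dots> \<le> (\<Sum>k\<le>N. ?B k * (L * ((a + (k / N - x)\<^sup>2 / a) / 2)))"
  proof (intro sum_mono mult_left_mono B0 L)
    fix k
    have "0 \<le> (a - \<bar>k / N - x\<bar>)\<^sup>2" by simp
    then have "2 * a * \<bar>k / N - x\<bar> \<le> a * a + (k / N - x)\<^sup>2"
      by (simp add: power2_eq_square algebra_simps abs_mult_self_eq)
    then show "\<bar>k / N - x\<bar> \<le> (a + (k / N - x)\<^sup>2 / a) / 2" using a(1) by (simp add: field_simps)
  qed
  also have "\<dots> = (\<Sum>k\<le>N. L / 2 * (a * ?B k + (k / N - x)\<^sup>2 * ?B k / a))"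
    by (intro sum.cong refl) (simp add: algebra_simps)
  also have "\<dots> = L / 2 * (a * (\<Sum>k\<le>N. ?B k) + (\<Sum>k\<le>N. (k / N - x)\<^sup>2 * ?B k) / a)"
    by (simp only: sum_distrib_left[symmetric] sum.distrib sum_divide_distrib)
  also have "(\<Sum>k\<le>N. (k / N - x)\<^sup>2 * ?B k) = x * (1 - x) / N"
  proof -
    \<comment> \<open>The square is expanded in \<open>k * (k - 1)\<close>, \<open>k\<close> and 1,
      whose means under the Bernstein weights are known.\<close>
    have "(k / N - x)\<^sup>2 * ?B k = (real k * (real k - 1) * ?B k + (1 - 2 * N * x) * (real k * ?B k)
        + (N * x)\<^sup>2 * ?B k) / (real N)\<^sup>2" for k
      using N by (simp add: power2_eq_square field_simps)
    then have "(\<Sum>k\<le>N. (k / N - x)\<^sup>2 * ?B k) =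
        (N * (real N - 1) * x\<^sup>2 + (1 - 2 * N * x) * (N * x) + (N * x)\<^sup>2) / (real N)\<^sup>2"
      by (simp add: sum.distrib flip: sum_divide_distrib sum_distrib_left)
    also have "\<dots> = x * (1 - x) / N" using N by (simp add: power2_eq_square field_simps)
    finally show ?thesis .
  qed
  also have "L / 2 * (a * (\<Sum>k\<le>N. ?B k) + x * (1 - x) / N / a) \<le> L / 2 * (a + a)"
  proof (intro mult_left_mono)
    have "x * (1 - x) \<le> 1" using x by (simp add: mult_le_one)
    then have "x * (1 - x) / N \<le> a * a" using N unfolding a(2) by (intro divide_right_mono) auto
    then have "x * (1 - x) / N / a \<le> a" unfolding pos_divide_le_eq[OF a(1)] .
    then show "a * (\<Sum>k\<le>N. ?B k) + x * (1 - x) / N / a \<le> a + a" by simp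
  qed (use L in auto)
  finally show ?thesis by (simp add: a_def)
qed

text \<open>On the interval where \<open>f\<close> is affine, the Bernstein polynomial differs from it only by the
  terms of index larger than \<open>m\<close>, which are small at complex points near \<open>0\<close> too.\<close>

lemma bernstein_sum_affine_end:
  fixes f :: "real \<Rightarrow> complex ^ 'n"
  assumes m: "m > 0" and aff: "\<And>y. 0 \<le> y \<Longrightarrow> y \<le> 1 / 3 \<Longrightarrow> f y = p + y *\<^sub>R V"
    and bd: "\<And>y. 0 \<le> y \<Longrightarrow> y \<le> 1 \<Longrightarrow> norm (f y - (p + y *\<^sub>R V)) \<le> R"
    and u: "norm u \<le> 1"
  shows "norm (bernstein_sum (3 * m) f u - (p + u *s V)) \<le> R * (64 * norm u) ^ m"
proof -
  let ?N = "3 * m"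
  have R: "R \<ge> 0" using bd[of 0] by (meson norm_ge_zero order_refl order_trans zero_le_one)
  have "p + u *s V = (\<Sum>k\<le>?N. bernstein_weight ?N k u *s (p + (k / ?N) *\<^sub>R V))"
  proof -
    have "(\<Sum>k\<le>?N. bernstein_weight ?N k u *s (p + (k / ?N) *\<^sub>R V)) =
      (\<Sum>k\<le>?N. bernstein_weight ?N k u *s p) + (\<Sum>k\<le>?N. (of_nat k * bernstein_weight ?N k u / of_nat ?N) *s V)"
      unfolding sum.distrib[symmetric]
      by (intro sum.cong refl)
        (simp add: vector_add_ldistrib flip: of_real_vector_scalar_mult)
    also have "\<dots> = p + u *s V"
      unfolding sum_vector_scalar_mult_left[symmetric] sum_bernstein_weight
        sum_divide_distrib[symmetric] sum_k_bernstein_weight using m by simp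
    finally show ?thesis by simp
  qed
  then have "bernstein_sum ?N f u - (p + u *s V) =
      (\<Sum>k\<le>?N. bernstein_weight ?N k u *s (f (k / ?N) - (p + (k / ?N) *\<^sub>R V)))"
    unfolding bernstein_sum_def by (simp only: vector_ssub_ldistrib sum_subtractf)
  also have "norm \<dots> \<le> (\<Sum>k\<le>?N. real (?N choose k) * (norm u ^ m * 2 ^ ?N * R))"
  proof (rule sum_norm_le)
    fix k assume k: "k \<in> {..?N}"
    let ?d = "f (k / ?N) - (p + (k / ?N) *\<^sub>R V)"
    show "norm (bernstein_weight ?N k u *s ?d) \<le> real (?N choose k) * (norm u ^ m * 2 ^ ?N * R)"
    proof (cases "k \<le> m")
      case True
      \<comment> \<open>\<open>k \<le> m\<close> means that the node \<open>k / (3 * m)\<close> is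
        at most 1/3, where \<open>f\<close> is affine.\<close>
      then have "?d = 0" using m aff[of "k / ?N"] by (simp add: field_simps)
      then show ?thesis using R by simp
    next
      case False
      have "norm (1 - u) \<le> 2" using norm_triangle_ineq4[of 1 u] u by simp
      then have "norm (1 - u) ^ (?N - k) \<le> 2 ^ (?N - k)" by (intro power_mono) auto
      also have "\<dots> \<le> 2 ^ ?N" by (intro power_increasing) auto
      finally have 1: "norm (1 - u) ^ (?N - k) \<le> 2 ^ ?N" .
      have 2: "norm u ^ k \<le> norm u ^ m" using False u by (intro power_decreasing) auto
      have 3: "norm ?d \<le> R" using k m by (intro bd) auto
      have "norm (bernstein_weight ?N k u *s ?d) =
          real (?N choose k) * (norm u ^ k * norm (1 - u) ^ (?N - k) * norm ?d)"
        unfolding norm_vector_scalar_mult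
        by (simp add: bernstein_weight_def norm_mult norm_power mult.assoc)
      also have "\<dots> \<le> real (?N choose k) * (norm u ^ m * 2 ^ ?N * R)"
        by (intro mult_left_mono mult_mono 1 2 3) auto
      finally show ?thesis .
    qed
  qed
  also have "\<dots> = (\<Sum>k\<le>?N. real (?N choose k)) * (norm u ^ m * 2 ^ ?N * R)"
    by (simp only: sum_distrib_right)
  also have "(\<Sum>k\<le>?N. real (?N choose k)) = 2 ^ ?N"
    using choose_row_sum[of ?N] by (metis of_nat_numeral of_nat_power of_nat_sum)
  \<comment> \<open>One factor \<open>2 ^ (3 * m)\<close> bounds the powers of \<open>1 - u\<close>,
    the other is the sum of the binomial coefficients; together they give
    \<open>64 ^ m\<close>.\<close>
  also have "2 ^ ?N * (norm u ^ m * 2 ^ ?N * R) = R * (64 * norm u) ^ m"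
  proof -
    have "(2::real) ^ ?N * 2 ^ ?N = 64 ^ m" by (simp add: power_mult flip: power_mult_distrib)
    then show ?thesis by (simp add: power_mult_distrib mult_ac)
  qed
  finally show ?thesis .
qed

text \<open>The degree of the Bernstein sum depends on \<open>R\<close>, \<open>L\<close> and
  \<open>\<delta>\<close> only, so one \<open>\<eta>\<close> works for all paths: it comes from the
  uniform continuity of finitely many weights and a common bound on the values of \<open>f\<close>.
  The quadratic error at the ends is what the cusps tolerate.\<close>

lemma holomorphic_path:
  assumes \<delta>: "\<delta> > 0"
  obtains \<eta> where "\<eta> > 0"
    "\<forall>(p :: complex ^ 'n) V p' V' (s :: real) (s' :: real) f.
      norm p \<le> R \<longrightarrow> norm V \<le> R \<longrightarrow> norm p' \<le> R \<longrightarrow> norm V' \<le> R \<longrightarrow>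
      0 < s \<longrightarrow> s \<le> 1 / 128 \<longrightarrow> 0 < s' \<longrightarrow> s' \<le> 1 / 128 \<longrightarrow> L-lipschitz_on {0..1} f \<longrightarrow>
      (\<forall>y. 0 \<le> y \<longrightarrow> y \<le> 1 / 3 \<longrightarrow> f y = p + y *\<^sub>R V) \<longrightarrow>
      (\<forall>y. 0 \<le> y \<longrightarrow> y \<le> 1 / 3 \<longrightarrow> f (1 - y) = p' + y *\<^sub>R V') \<longrightarrow>
      (\<exists>P. (\<forall>i. (\<lambda>u. P u $ i) holomorphic_on UNIV) \<and>
        P (of_real s) = p + s *\<^sub>R V \<and> P (of_real (1 - s')) = p' + s' *\<^sub>R V' \<and>
        (\<forall>u. norm u \<le> 1 / 128 \<longrightarrow> norm (P u - (p + u *s V)) \<le> \<delta> * (norm u)\<^sup>2) \<and>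
        (\<forall>u. norm u \<le> 1 / 128 \<longrightarrow> norm (P (1 - u) - (p' + u *s V')) \<le> \<delta> * (norm u)\<^sup>2) \<and>
        (\<forall>u y. y \<in> {0..1} \<longrightarrow> dist u (of_real y) < \<eta> \<longrightarrow> dist (P u) (f y) < \<delta>))"
proof -
  \<comment> \<open>It bounds both \<open>f\<close>, by \<open>R + L\<close>, and the distance of
    \<open>f\<close> from either affine end, by \<open>3 * R + L\<close>. The absolute value and the
    summand 1 make it positive whatever the signs of \<open>R\<close> and \<open>L\<close>.\<close>
  define R1 where "R1 = \<bar>3 * R + L\<bar> + 1"
  have R1: "R1 > 0" by (simp add: R1_def)
  \<comment> \<open>The errors will add up to \<open>193 * \<delta>'\<close> times
    \<open>(norm u)\<^sup>2\<close> near the ends and to \<open>1730 * \<delta>'\<close> in the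
    middle.\<close>
  define \<delta>' where "\<delta>' = \<delta> / 2000"
  have \<delta>': "\<delta>' > 0" using \<delta> by (simp add: \<delta>'_def)
  obtain m1 where "(1 / 2) ^ m1 < \<delta>' / (4096 * R1)"
    using real_arch_pow_inv[of "\<delta>' / (4096 * R1)" "1 / 2"] \<delta>' R1 by auto
  then have m1: "R1 * 4096 * (1 / 2) ^ m1 \<le> \<delta>'" using R1 by (simp add: field_simps)
  obtain m2 where m2: "(L / \<delta>')\<^sup>2 < real m2" using reals_Archimedean2 by blast
  \<comment> \<open>\<open>m1\<close> controls the error near the ends, with two factors
    \<open>64 * norm u\<close> set aside for the quadratic bound; \<open>m2\<close> controls the
    error on the whole interval.\<close>
  define m where "m = max (m1 + 2) m2"
  define N where "N = 3 * m"
  have N: "N > 0" "m > 0" by (auto simp: N_def m_def)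
  have "(1 / 2 :: real) ^ (m - 2) \<le> (1 / 2) ^ m1" by (intro power_decreasing) (auto simp: m_def)
  then have m_end: "R1 * 4096 * (1 / 2) ^ (m - 2) \<le> \<delta>'"
    using m1 R1 by (meson mult_left_mono order_trans less_imp_le mult_nonneg_nonneg zero_le_numeral)
  have m_mid: "L / sqrt N \<le> \<delta>'"
  proof -
    have "m2 \<le> m" by (simp add: m_def)
    then have "m2 \<le> N" by (simp add: N_def)
    then have "real m2 \<le> real N" by simp
    then have "(L / \<delta>')\<^sup>2 \<le> real N" using m2 by linarith
    then have "L / \<delta>' \<le> sqrt N" by (rule real_le_rsqrt)
    then show ?thesis using \<delta>' N by (simp add: field_simps)
  qed
  have "\<exists>\<eta>>0. \<forall>u\<in>cball 0 2. \<forall>y\<in>cball 0 2. dist u y < \<eta> \<longrightarrow>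
      dist (bernstein_weight N k u) (bernstein_weight N k y) < \<delta>' / ((N + 1) * R1)" for k
  proof -
    have "continuous_on (cball 0 2) (bernstein_weight N k)"
      unfolding bernstein_weight_def by (intro continuous_intros)
    then have "uniformly_continuous_on (cball 0 2) (bernstein_weight N k)"
      by (intro compact_uniformly_continuous) auto
    moreover have "0 < \<delta>' / ((N + 1) * R1)" using \<delta>' R1 by simp
    ultimately show ?thesis unfolding uniformly_continuous_on_def by (metis dist_commute)
  qed
  then obtain \<eta>k where \<eta>k: "\<And>k. \<eta>k k > 0" and
    \<eta>k_le: "\<And>k u y. u \<in> cball 0 2 \<Longrightarrow> y \<in> cball 0 2 \<Longrightarrow> dist u y < \<eta>k k \<Longrightarrow>
      dist (bernstein_weight N k u) (bernstein_weight N k y) < \<delta>' / ((N + 1) * R1)"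
    by metis
  \<comment> \<open>The inserted 1 keeps the points within \<open>\<eta>\<close> of the unit
    interval in \<open>cball 0 2\<close>.\<close>
  define \<eta> where "\<eta> = Min (insert 1 (\<eta>k ` {..N}))"
  have \<eta>: "\<eta> > 0" "\<eta> \<le> 1" "\<And>k. k \<le> N \<Longrightarrow> \<eta> \<le> \<eta>k k"
    using \<eta>k by (auto simp: \<eta>_def intro: min.coboundedI2 Min_le)
  show thesis
  proof
    show "\<eta> > 0" by fact
  next
    show "\<forall>(p :: complex ^ 'n) V p' V' (s :: real) (s' :: real) f.
      norm p \<le> R \<longrightarrow> norm V \<le> R \<longrightarrow> norm p' \<le> R \<longrightarrow> norm V' \<le> R \<longrightarrow>
      0 < s \<longrightarrow> s \<le> 1 / 128 \<longrightarrow> 0 < s' \<longrightarrow> s' \<le> 1 / 128 \<longrightarrow> L-lipschitz_on {0..1} f \<longrightarrow>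
      (\<forall>y. 0 \<le> y \<longrightarrow> y \<le> 1 / 3 \<longrightarrow> f y = p + y *\<^sub>R V) \<longrightarrow>
      (\<forall>y. 0 \<le> y \<longrightarrow> y \<le> 1 / 3 \<longrightarrow> f (1 - y) = p' + y *\<^sub>R V') \<longrightarrow>
      (\<exists>P. (\<forall>i. (\<lambda>u. P u $ i) holomorphic_on UNIV) \<and>
        P (of_real s) = p + s *\<^sub>R V \<and> P (of_real (1 - s')) = p' + s' *\<^sub>R V' \<and>
        (\<forall>u. norm u \<le> 1 / 128 \<longrightarrow> norm (P u - (p + u *s V)) \<le> \<delta> * (norm u)\<^sup>2) \<and>
        (\<forall>u. norm u \<le> 1 / 128 \<longrightarrow> norm (P (1 - u) - (p' + u *s V')) \<le> \<delta> * (norm u)\<^sup>2) \<and>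
        (\<forall>u y. y \<in> {0..1} \<longrightarrow> dist u (of_real y) < \<eta> \<longrightarrow> dist (P u) (f y) < \<delta>))"
    proof (intro allI impI)
    fix p V p' V' :: "complex ^ 'n" and s s' :: real and f
    assume R: "norm p \<le> R" "norm V \<le> R" "norm p' \<le> R" "norm V' \<le> R"
      and s: "0 < s" "s \<le> 1 / 128" and s': "0 < s'" "s' \<le> 1 / 128"
      and f: "L-lipschitz_on {0..1} f"
      and "\<forall>y. 0 \<le> y \<longrightarrow> y \<le> 1 / 3 \<longrightarrow> f y = p + y *\<^sub>R V"
      and "\<forall>y. 0 \<le> y \<longrightarrow> y \<le> 1 / 3 \<longrightarrow> f (1 - y) = p' + y *\<^sub>R V'"
    then have f0: "f y = p + y *\<^sub>R V" and f1: "f (1 - y) = p' + y *\<^sub>R V'" if "0 \<le> y" "y \<le> 1 / 3" for y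
      using that by auto
    have L: "L \<ge> 0" using f by (rule lipschitz_on_nonneg)
    have nR: "R \<ge> 0" using R(1) norm_ge_zero order_trans by blast
    have nf: "norm (f y) \<le> R + L" if "0 \<le> y" "y \<le> 1" for y
    proof -
      have "norm (f y - f 0) \<le> L * norm (y - 0)" using that by (intro lipschitz_on_normD[OF f]) auto
      also have "\<dots> \<le> L" using that L by (simp add: mult_left_le)
      finally show ?thesis using f0[of 0] R(1) norm_triangle_ineq2[of "f y" p] by simp
    qed
    have tail: "norm (g y - (a + y *\<^sub>R b)) \<le> R1"
      if "norm (g y) \<le> R + L" "norm a \<le> R" "norm b \<le> R" "0 \<le> y" "y \<le> 1" for g y and a b :: "complex ^ 'n"
    proof -
      have "norm (y *\<^sub>R b) \<le> R" using that by (simp add: mult_left_le_one_le order_trans[OF mult_left_le_one_le])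
      then show ?thesis
        using norm_triangle_ineq4[of "g y" "a + y *\<^sub>R b"] norm_triangle_ineq[of a "y *\<^sub>R b"] that
        unfolding R1_def by linarith
    qed
    let ?b = "bernstein_sum N f"
    have small: "R1 * (64 * norm u) ^ m \<le> \<delta>' * (norm u)\<^sup>2" if "norm u \<le> 1 / 128" for u :: complex
    proof -
      \<comment> \<open>Of the \<open>m\<close> factors \<open>64 * norm u\<close>, two supply the
        square and the others are at most 1/2.\<close>
      have "m = (m - 2) + 2" by (simp add: m_def)
      then have "(64 * norm u) ^ m = (64 * norm u) ^ (m - 2) * (64 * norm u)\<^sup>2" by (metis power_add)
      also have "\<dots> \<le> (1 / 2) ^ (m - 2) * (64 * norm u)\<^sup>2"
        using that by (intro mult_right_mono power_mono) auto
      finally have "R1 * (64 * norm u) ^ m \<le> R1 * ((1 / 2) ^ (m - 2) * (64 * norm u)\<^sup>2)"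
        using R1 by simp
      also have "\<dots> = (R1 * 4096 * (1 / 2) ^ (m - 2)) * (norm u)\<^sup>2" by (simp add: power_mult_distrib)
      also have "\<dots> \<le> \<delta>' * (norm u)\<^sup>2" by (intro mult_right_mono m_end) auto
      finally show ?thesis .
    qed
    have b0: "norm (?b u - (p + u *s V)) \<le> \<delta>' * (norm u)\<^sup>2" if u: "norm u \<le> 1 / 128" for u
    proof -
      have "norm (?b u - (p + u *s V)) \<le> R1 * (64 * norm u) ^ m"
        unfolding N_def using f0 nf R u N by (intro bernstein_sum_affine_end tail) auto
      then show ?thesis using small[OF u] by linarith
    qed
    have b1: "norm (?b (1 - u) - (p' + u *s V')) \<le> \<delta>' * (norm u)\<^sup>2" if u: "norm u \<le> 1 / 128" for u
    proof -
      have "norm (?b (1 - u) - (p' + u *s V')) \<le> R1 * (64 * norm u) ^ m"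
        unfolding bernstein_sum_reflect[OF N(1)] unfolding N_def
        using f1 nf R u N by (intro bernstein_sum_affine_end tail[where g = "\<lambda>y. f (1 - y)"]) auto
      then show ?thesis using small[OF u] by linarith
    qed
    \<comment> \<open>The distance between the two nodes; it is the value of either linear factor of
      \<open>E\<close> at the node where the other one vanishes.\<close>
    define d where "d = 1 - s' - s"
    have d: "d \<ge> 1 / 2" "d \<le> 1" using s s' by (auto simp: d_def)
    \<comment> \<open>\<open>?b\<close> misses the prescribed points slightly; the correction \<open>E\<close> restores them and vanishes to
      second order at \<open>0\<close> and \<open>1\<close>, which preserves the quadratic estimates there.\<close>
    define \<alpha> where "\<alpha> = (1 / (s\<^sup>2 * (1 - s)\<^sup>2 * d)) *\<^sub>R (p + s *\<^sub>R V - ?b (of_real s))"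
    define \<beta> where "\<beta> = (1 / (s'\<^sup>2 * (1 - s')\<^sup>2 * d)) *\<^sub>R (p' + s' *\<^sub>R V' - ?b (of_real (1 - s')))"
    \<comment> \<open>The error of \<open>?b\<close> at a node \<open>t\<close> is at most
      \<open>\<delta>' * t\<^sup>2\<close>, which cancels the small denominator; hence the bound is
      uniform as the nodes approach the ends.\<close>
    have coeff: "norm ((1 / (t\<^sup>2 * (1 - t)\<^sup>2 * d)) *\<^sub>R x) \<le> 8 * \<delta>'"
      if "0 < t" "t \<le> 1 / 128" "norm x \<le> \<delta>' * t\<^sup>2" for t and x :: "complex ^ 'n"
    proof -
      have "(1 - t)\<^sup>2 \<ge> (1 / 2)\<^sup>2" using that by (intro power_mono) auto
      then have "(1 - t)\<^sup>2 * d \<ge> (1 / 2)\<^sup>2 * (1 / 2)" using d by (intro mult_mono) auto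
      then have g: "(1 - t)\<^sup>2 * d \<ge> 1 / 8" by (simp add: power2_eq_square)
      have "norm ((1 / (t\<^sup>2 * (1 - t)\<^sup>2 * d)) *\<^sub>R x) = norm x / (t\<^sup>2 * ((1 - t)\<^sup>2 * d))"
        using d by (simp add: mult.assoc)
      also have "\<dots> \<le> (\<delta>' * t\<^sup>2) / (t\<^sup>2 * (1 / 8))"
        using that g \<delta>' by (intro frac_le mult_left_mono) auto
      also have "\<dots> = 8 * \<delta>'" using that by simp
      finally show ?thesis .
    qed
    have \<alpha>: "norm \<alpha> \<le> 8 * \<delta>'" unfolding \<alpha>_def
    proof (rule coeff[OF s])
      show "norm (p + s *\<^sub>R V - ?b (of_real s)) \<le> \<delta>' * s\<^sup>2"
        using b0[of "of_real s"] s by (simp add: of_real_vector_scalar_mult norm_minus_commute)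
    qed
    have \<beta>: "norm \<beta> \<le> 8 * \<delta>'" unfolding \<beta>_def
    proof (rule coeff[OF s'])
      show "norm (p' + s' *\<^sub>R V' - ?b (of_real (1 - s'))) \<le> \<delta>' * s'\<^sup>2"
        using b1[of "of_real s'"] s' by (simp add: of_real_vector_scalar_mult norm_minus_commute)
    qed
    define E where "E u = (u\<^sup>2 * (1 - u)\<^sup>2) *s ((of_real (1 - s') - u) *s \<alpha> + (u - of_real s) *s \<beta>)" for u
    have E: "norm (E u) \<le> (norm u)\<^sup>2 * (norm (1 - u))\<^sup>2 * (48 * \<delta>')" if u: "norm u \<le> 2" for u
    proof -
      have 1: "norm (of_real (1 - s') - u) \<le> 3"
        using norm_triangle_ineq4[of "of_real (1 - s')" u] u s' by (simp del: of_real_diff)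
      have 2: "norm (u - of_real s) \<le> 3"
        using norm_triangle_ineq4[of u "of_real s"] u s by simp
      have "norm ((of_real (1 - s') - u) *s \<alpha> + (u - of_real s) *s \<beta>) \<le> 3 * (8 * \<delta>') + 3 * (8 * \<delta>')"
        by (intro norm_triangle_mono) (unfold norm_vector_scalar_mult, (intro mult_mono 1 2 \<alpha> \<beta>; simp)+)
      then show ?thesis
        unfolding E_def norm_vector_scalar_mult norm_mult norm_power
        by (intro mult_left_mono) auto
    qed
    define P where "P u = ?b u + E u" for u
    have near: "norm (E u) \<le> 192 * \<delta>' * (norm u)\<^sup>2 \<and> norm (E (1 - u)) \<le> 192 * \<delta>' * (norm u)\<^sup>2"
      if u: "norm u \<le> 1 / 128" for u
    proof -
      have "norm (1 - u) \<le> 2" using norm_triangle_ineq4[of 1 u] u by simp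
      moreover from this have "(norm (1 - u))\<^sup>2 \<le> 2\<^sup>2" by (intro power_mono) auto
      then have "(norm u)\<^sup>2 * (norm (1 - u))\<^sup>2 * (48 * \<delta>') \<le> (norm u)\<^sup>2 * 2\<^sup>2 * (48 * \<delta>')"
        using \<delta>' by (intro mult_right_mono mult_left_mono) auto
      ultimately show ?thesis using E[of u] E[of "1 - u"] u by (simp add: mult_ac)
    qed
    have small': "193 * \<delta>' * x \<le> \<delta> * x" if "x \<ge> 0" for x
      using that \<delta> by (intro mult_right_mono) (auto simp: \<delta>'_def)
    show "\<exists>P. (\<forall>i. (\<lambda>u. P u $ i) holomorphic_on UNIV) \<and>
        P (of_real s) = p + s *\<^sub>R V \<and> P (of_real (1 - s')) = p' + s' *\<^sub>R V' \<and>
        (\<forall>u. norm u \<le> 1 / 128 \<longrightarrow> norm (P u - (p + u *s V)) \<le> \<delta> * (norm u)\<^sup>2) \<and>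
        (\<forall>u. norm u \<le> 1 / 128 \<longrightarrow> norm (P (1 - u) - (p' + u *s V')) \<le> \<delta> * (norm u)\<^sup>2) \<and>
        (\<forall>u y. y \<in> {0..1} \<longrightarrow> dist u (of_real y) < \<eta> \<longrightarrow> dist (P u) (f y) < \<delta>)"
    proof (intro exI[of _ P] conjI allI impI)
      show "(\<lambda>u. P u $ i) holomorphic_on UNIV" for i
        unfolding P_def E_def bernstein_sum_def bernstein_weight_def
        by (simp, intro holomorphic_intros)
      have od: "complex_of_real (1 - s') - of_real s = of_real d" by (simp add: d_def)
      have 1: "E (of_real s) = of_real (s\<^sup>2 * (1 - s)\<^sup>2 * d) *s \<alpha>"
        unfolding E_def od diff_self vector_smult_lzero add_0_right vector_smult_assoc by simp
      show "P (of_real s) = p + s *\<^sub>R V"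
        unfolding P_def 1 of_real_vector_scalar_mult using s d by (simp add: \<alpha>_def)
      have 2: "E (of_real (1 - s')) = of_real (s'\<^sup>2 * (1 - s')\<^sup>2 * d) *s \<beta>"
        unfolding E_def od diff_self vector_smult_lzero add_0_left vector_smult_assoc
        by (simp add: mult_ac)
      show "P (of_real (1 - s')) = p' + s' *\<^sub>R V'"
        unfolding P_def 2 of_real_vector_scalar_mult using s' d by (simp add: \<beta>_def)
    next
      fix u :: complex assume u: "norm u \<le> 1 / 128"
      have "norm (P u - (p + u *s V)) \<le> norm (?b u - (p + u *s V)) + norm (E u)"
        unfolding P_def by (metis add_diff_eq add.commute norm_triangle_ineq)
      then show "norm (P u - (p + u *s V)) \<le> \<delta> * (norm u)\<^sup>2"
        using b0[OF u] near[OF u] small'[of "(norm u)\<^sup>2"] by simp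
      have "norm (P (1 - u) - (p' + u *s V')) \<le> norm (?b (1 - u) - (p' + u *s V')) + norm (E (1 - u))"
        unfolding P_def by (metis add_diff_eq add.commute norm_triangle_ineq)
      then show "norm (P (1 - u) - (p' + u *s V')) \<le> \<delta> * (norm u)\<^sup>2"
        using b1[OF u] near[OF u] small'[of "(norm u)\<^sup>2"] by simp
    next
      fix u :: complex and y :: real assume y: "y \<in> {0..1}" and uy: "dist u (of_real y) < \<eta>"
      have u: "norm u \<le> 2"
        using uy \<eta>(2) y norm_triangle_ineq2[of u "of_real y"] by (simp add: dist_norm)
      have bb: "norm (?b u - ?b (of_real y)) \<le> \<delta>'"
      proof -
        have "?b u - ?b (of_real y) =
            (\<Sum>k\<le>N. (bernstein_weight N k u - bernstein_weight N k (of_real y)) *s f (k / N))"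
          unfolding bernstein_sum_def by (simp add: vector_sub_rdistrib sum_subtractf)
        also have "norm \<dots> \<le> (\<Sum>k\<le>N. \<delta>' / ((N + 1) * R1) * R1)"
        proof (rule sum_norm_le)
          fix k assume k: "k \<in> {..N}"
          have "dist (bernstein_weight N k u) (bernstein_weight N k (of_real y)) < \<delta>' / ((N + 1) * R1)"
            using u y uy \<eta>(3)[of k] k by (intro \<eta>k_le) auto
          moreover have "norm (f (k / N)) \<le> R1" using nf[of "k / N"] k N nR L by (simp add: R1_def)
          ultimately show "norm ((bernstein_weight N k u - bernstein_weight N k (of_real y)) *s f (k / N))
              \<le> \<delta>' / ((N + 1) * R1) * R1"
            unfolding norm_vector_scalar_mult using \<delta>' R1 by (intro mult_mono) (auto simp: dist_norm)
        qed
        also have "\<dots> = \<delta>'"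
        proof -
          have "R1 + R1 * real N > 0" using R1 by (simp add: add_pos_nonneg)
          then show ?thesis using R1 by (simp add: field_simps)
        qed
        finally show ?thesis .
      qed
      have bf: "norm (?b (of_real y) - f y) \<le> \<delta>'"
        using bernstein_sum_lipschitz_approx[OF f y N(1)] m_mid by linarith
      have EE: "norm (E u) \<le> 1728 * \<delta>'"
      proof -
        have "norm (1 - u) \<le> 3" using norm_triangle_ineq4[of 1 u] u by simp
        then have "(norm u)\<^sup>2 * (norm (1 - u))\<^sup>2 * (48 * \<delta>') \<le> 2\<^sup>2 * 3\<^sup>2 * (48 * \<delta>')"
          using u \<delta>' by (intro mult_right_mono mult_mono power_mono) auto
        also have "\<dots> = 1728 * \<delta>'" by simp
        finally show ?thesis using E[OF u] by linarith
      qed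
      \<comment> \<open>The three terms are the change of argument, the Bernstein approximation at a
        real point, and the correction.\<close>
      have eq: "P u - f y = (?b u - ?b (of_real y)) + (?b (of_real y) - f y) + E u" by (simp add: P_def)
      have "norm (P u - f y) \<le> \<delta>' + \<delta>' + 1728 * \<delta>'"
        unfolding eq by (intro norm_triangle_mono bb bf EE)
      also have "\<dots> < \<delta>" using \<delta> by (simp add: \<delta>'_def)
      finally show "dist (P u) (f y) < \<delta>" by (simp add: dist_norm)
    qed
    qed
  qed
qed

section \<open>The model disc\<close>

text \<open>For \<open>\<bar>t\<bar> \<ge> pi / 4\<close> the addition theorem produces the negative
  term \<open>- sin t * sin (e * t)\<close> (for \<open>t > 0\<close>). For smaller
  \<open>\<bar>t\<bar>\<close> the second copy of \<open>cos t\<close> dominates the constant. At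
  \<open>\<bar>t\<bar> = pi / 2\<close> the right-hand side is negative.\<close>

lemma cos_mult_le:
  assumes e: "0 < e" "e \<le> 1 / 2" and t: "\<bar>t\<bar> \<le> pi / 2"
  shows "cos ((1 + e) * t) \<le> 2 * cos t - sin (pi / 4) * sin (e * (pi / 4))"
proof -
  have *: "cos ((1 + e) * t) \<le> 2 * cos t - sin (pi / 4) * sin (e * (pi / 4))"
    if t: "0 \<le> t" "t \<le> pi / 2" for t
  proof -
    have et: "0 \<le> e * t" "e * t \<le> pi / 4"
      using e t mult_mono[of e "1 / 2" t "pi / 2"] by auto
    have e4: "0 \<le> e * (pi / 4)" "e * (pi / 4) \<le> pi / 2" using e by (auto simp: field_simps)
    have s4: "0 \<le> sin (e * (pi / 4))" using e4 by (intro sin_ge_zero) auto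
    have ct: "0 \<le> cos t" using t by (intro cos_ge_zero) auto
    show ?thesis
    proof (cases "t \<ge> pi / 4")
      case True
      have "cos ((1 + e) * t) = cos t * cos (e * t) - sin t * sin (e * t)"
        by (simp add: algebra_simps cos_add)
      moreover have "cos t * cos (e * t) \<le> cos t" using ct by (simp add: mult_left_le)
      moreover have "sin (pi / 4) * sin (e * (pi / 4)) \<le> sin t * sin (e * t)"
      proof (rule mult_mono)
        show "sin (pi / 4) \<le> sin t" using True t by (intro sin_monotone_2pi_le) auto
        show "sin (e * (pi / 4)) \<le> sin (e * t)"
        proof (rule sin_monotone_2pi_le)
          show "- (pi / 2) \<le> e * (pi / 4)" using e4(1) pi_gt_zero by linarith
          show "e * (pi / 4) \<le> e * t" using True e by (intro mult_left_mono) auto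
          show "e * t \<le> pi / 2" using et pi_gt_zero by linarith
        qed
        show "0 \<le> sin t" using t by (intro sin_ge_zero) auto
      qed (use s4 in auto)
      ultimately show ?thesis using ct by linarith
    next
      case False
      have "cos ((1 + e) * t) \<le> cos t"
        using t et e by (intro cos_monotone_0_pi_le) (auto simp: algebra_simps)
      moreover have "cos (pi / 4) \<le> cos t" using t False by (intro cos_monotone_0_pi_le) auto
      moreover have "sin (pi / 4) * sin (e * (pi / 4)) \<le> sin (pi / 4)"
        using sin_ge_zero[of "pi / 4"] by (simp add: mult_left_le)
      moreover have "sin (pi / 4) = cos (pi / 4)" by (simp add: sin_45 cos_45)
      ultimately show ?thesis using ct by linarith
    qed
  qed
  have "cos ((1 + e) * \<bar>t\<bar>) \<le> 2 * cos \<bar>t\<bar> - sin (pi / 4) * sin (e * (pi / 4))"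
    using t by (intro *) auto
  then show ?thesis by (cases "t \<ge> 0") auto
qed

text \<open>This is \<open>cos_mult_le\<close> at the argument \<open>t\<close> of \<open>z\<close>,
  multiplied by \<open>norm z powr (1 + e)\<close>.\<close>

lemma Re_powr_le:
  assumes e: "0 < e" "e \<le> 1 / 2" and z: "Re z > 0"
  shows "Re (z powr of_real (1 + e)) \<le> 2 * Re z * norm z powr e - sin (pi / 4) * sin (e * (pi / 4)) * norm z powr (1 + e)"
proof -
  have z0: "z \<noteq> 0" using z by auto
  define t where "t = Im (Ln z)"
  have t: "\<bar>t\<bar> \<le> pi / 2" using Re_Ln_pos_lt_imp[OF z] by (simp add: t_def)
  have ReLn: "Re (Ln z) = ln (norm z)" using z0 by (rule Re_Ln)
  have "Re z = Re (exp (Ln z))" using z0 by simp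
  also have "\<dots> = norm z * cos t" unfolding Re_exp ReLn t_def using z0 by simp
  finally have Rez: "Re z = norm z * cos t" .
  have "Re (z powr of_real (1 + e)) = norm z powr (1 + e) * cos ((1 + e) * t)"
    using z0 by (simp add: powr_def Re_exp ReLn t_def del: of_real_add)
  also have "\<dots> \<le> norm z powr (1 + e) * (2 * cos t - sin (pi / 4) * sin (e * (pi / 4)))"
    by (intro mult_left_mono cos_mult_le e t) auto
  also have "\<dots> = 2 * Re z * norm z powr e - sin (pi / 4) * sin (e * (pi / 4)) * norm z powr (1 + e)"
    unfolding Rez by (simp add: powr_add algebra_simps)
  finally show ?thesis .
qed

text \<open>Near \<open>0\<close> the map is \<open>z - z powr (1 + e)\<close> to leading order, and \<open>Re (z powr (1 + e))\<close> is negative of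
  order \<open>norm z powr (1 + e)\<close> along the imaginary axis: this pushes the half-plane into a cusp
  \<open>Re u \<ge> c * norm u powr (1 + e)\<close>. The remaining factors make the map commute with \<open>z \<mapsto> 1 - z\<close>.\<close>

definition cusp_map :: "real \<Rightarrow> complex \<Rightarrow> complex" where
  "cusp_map e z = z - (1 - 2 * z) * (z powr of_real (1 + e) * (1 - z) powr of_real (1 + e))"

lemma cusp_map_reflect: "cusp_map e (1 - z) = 1 - cusp_map e z"
  by (simp add: cusp_map_def algebra_simps)

lemma holomorphic_on_cusp_map: "cusp_map e holomorphic_on {z. 0 < Re z \<and> Re z < 1}"
  unfolding cusp_map_def by (intro holomorphic_intros) (auto simp: complex_nonpos_Reals_iff)

lemma cusp_map_of_real:
  assumes "0 < x" "x < 1"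
  shows "cusp_map e (of_real x) =
    of_real (x - (1 - 2 * x) * (x powr (1 + e) * (1 - x) powr (1 + e)))"
proof -
  have "(1 - complex_of_real x) powr of_real (1 + e) = of_real ((1 - x) powr (1 + e))"
    using powr_of_real[of "1 - x" "1 + e"] assms by (simp del: of_real_add)
  moreover have "complex_of_real x powr of_real (1 + e) = of_real (x powr (1 + e))"
    using powr_of_real[of x "1 + e"] assms by (simp del: of_real_add)
  ultimately show ?thesis by (simp add: cusp_map_def del: of_real_add)
qed

text \<open>The map is \<open>z - w z * z powr (1 + e)\<close> with \<open>w 0 = 1\<close>. By
  \<open>Re_powr_le\<close> the real part gains \<open>\<sigma> * norm z powr (1 + e)\<close>; the
  loss \<open>2 * Re z * norm z powr e\<close> is covered by \<open>Re z\<close> for small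
  \<open>z\<close>, and replacing \<open>w\<close> by 1 costs at most half of the gain.\<close>

lemma cusp_map_near_0:
  assumes e: "0 < e" "e \<le> 1 / 2" and d: "d > 0"
  obtains \<rho> c where "\<rho> > 0" "c > 0"
    "\<And>z. 0 < Re z \<Longrightarrow> norm z \<le> \<rho> \<Longrightarrow> norm (cusp_map e z) \<le> d \<and> 0 < Re (cusp_map e z) \<and>
       c * norm (cusp_map e z) powr (1 + e) \<le> Re (cusp_map e z)"
proof -
  define \<sigma> where "\<sigma> = sin (pi / 4) * sin (e * (pi / 4))"
  have e4: "0 < e * (pi / 4)" "e * (pi / 4) < pi" using e by (auto simp: field_simps)
  have "0 < sin (e * (pi / 4))" using e4 by (rule sin_gt_zero)
  then have \<sigma>: "\<sigma> > 0" by (simp add: \<sigma>_def sin_45)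
  have \<sigma>1: "\<sigma> \<le> 1" unfolding \<sigma>_def using \<open>0 < sin (e * (pi / 4))\<close> by (intro mult_le_one) auto
  define w where "w z = (1 - 2 * z) * (1 - z) powr of_real (1 + e)" for z :: complex
  have "isCont w 0" unfolding w_def
    by (intro continuous_intros isCont_powr_complex) (auto simp: complex_nonpos_Reals_iff)
  then obtain r where r0: "r > 0" and r: "\<And>z. dist z 0 < r \<Longrightarrow> dist (w z) (w 0) < \<sigma> / 2"
    using \<sigma> unfolding continuous_at_eps_delta by (metis half_gt_zero)
  have w0: "w 0 = 1" by (simp add: w_def)
  \<comment> \<open>The entries ensure that \<open>w z\<close> is close to 1, that the image, of
    norm at most \<open>3 * norm z\<close>, stays within \<open>d\<close>, and that
    \<open>norm z powr e \<le> 1 / 2\<close>.\<close>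
  define \<rho> where "\<rho> = min (min (r / 2) (d / 3)) (min 1 ((1 / 2) powr (1 / e)))"
  define c where "c = \<sigma> / 2 / 3 powr (1 + e)"
  show thesis
  proof
    show "\<rho> > 0" "c > 0" using r0 d \<sigma> by (auto simp: \<rho>_def c_def)
    fix z :: complex assume z: "0 < Re z" "norm z \<le> \<rho>"
    let ?h = "cusp_map e z"
    have nz: "norm z > 0" using z by (metis complex_Re_le_cmod less_le_trans)
    have wz: "norm (w z - 1) \<le> \<sigma> / 2" using z r0 r[of z] by (simp add: \<rho>_def w0 dist_norm)
    have "norm z powr e \<le> ((1 / 2) powr (1 / e)) powr e"
      using z e by (intro powr_mono2) (auto simp: \<rho>_def)
    also have "\<dots> = 1 / 2" using e by (simp add: powr_powr)
    finally have pe: "norm z powr e \<le> 1 / 2" .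
    have np: "norm (z powr of_real (1 + e)) = norm z powr (1 + e)"
      by (simp add: norm_powr_real_powr' del: of_real_add)
    have h: "?h = z - z powr of_real (1 + e) - (w z - 1) * z powr of_real (1 + e)"
      by (simp add: cusp_map_def w_def algebra_simps)
    have "Re ((w z - 1) * z powr of_real (1 + e)) \<le> norm (w z - 1) * norm z powr (1 + e)"
      using complex_Re_le_cmod[of "(w z - 1) * z powr of_real (1 + e)"] unfolding norm_mult np .
    also have "\<dots> \<le> \<sigma> / 2 * norm z powr (1 + e)" by (intro mult_right_mono wz) auto
    finally have 1: "Re ((w z - 1) * z powr of_real (1 + e)) \<le> \<sigma> / 2 * norm z powr (1 + e)" .
    have 2: "Re (z powr of_real (1 + e)) \<le> 2 * Re z * norm z powr e - \<sigma> * norm z powr (1 + e)"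
      using Re_powr_le[OF e z(1)] unfolding \<sigma>_def .
    have 3: "2 * Re z * norm z powr e \<le> Re z"
      using mult_left_mono[OF pe, of "2 * Re z"] z(1) by simp
    have lower: "\<sigma> / 2 * norm z powr (1 + e) \<le> Re ?h"
      unfolding h minus_complex.sel using 1 2 3 by linarith
    have p1: "norm z powr (1 + e) \<le> norm z"
      using pe nz by (simp add: powr_add mult_left_le)
    have "norm ?h \<le> norm z + norm z powr (1 + e) + norm (w z - 1) * norm z powr (1 + e)"
      using norm_triangle_ineq4[of z "z powr of_real (1 + e)"]
        norm_triangle_ineq4[of "z - z powr of_real (1 + e)" "(w z - 1) * z powr of_real (1 + e)"]
      unfolding h norm_mult np by linarith
    also have "\<dots> \<le> norm z + norm z + 1 * norm z"
      using wz \<sigma>1 p1 by (intro add_mono mult_mono) auto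
    finally have up: "norm ?h \<le> 3 * norm z" by simp
    show "norm ?h \<le> d \<and> 0 < Re ?h \<and> c * norm ?h powr (1 + e) \<le> Re ?h"
    proof (intro conjI)
      show "norm ?h \<le> d" using up z by (simp add: \<rho>_def)
      have "0 < \<sigma> / 2 * norm z powr (1 + e)" using \<sigma> nz by simp
      then show "0 < Re ?h" using lower by linarith
      have "norm ?h powr (1 + e) \<le> (3 * norm z) powr (1 + e)" using up e by (intro powr_mono2) auto
      then have "c * norm ?h powr (1 + e) \<le> c * (3 powr (1 + e) * norm z powr (1 + e))"
        using \<sigma> by (intro mult_left_mono) (auto simp: c_def powr_mult)
      also have "\<dots> = \<sigma> / 2 * norm z powr (1 + e)" by (simp add: c_def)
      finally show "c * norm ?h powr (1 + e) \<le> Re ?h" using lower by linarith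
    qed
  qed
qed

text \<open>The real part of the segment is moved towards 0 but not past it, since
  \<open>x powr (1 + e) \<le> x\<close>. Hence a preimage of a point is at least as far from 0 as
  the point, and no linear rate is lost.\<close>

lemma cusp_map_real_bounds:
  fixes e x :: real
  assumes e: "0 < e" and x: "0 < x" "x \<le> 1 / 2"
  defines "y \<equiv> x - (1 - 2 * x) * (x powr (1 + e) * (1 - x) powr (1 + e))"
  shows "0 < y" "y \<le> x"
proof -
  have "x powr (1 + e) \<le> x powr 1" using x e by (intro powr_mono') auto
  moreover have "(1 - x) powr (1 + e) \<le> (1 - x) powr 1" using x e by (intro powr_mono') auto
  ultimately have "x powr (1 + e) * (1 - x) powr (1 + e) \<le> x * (1 - x)"
    using x by (intro mult_mono) auto
  then have "(1 - 2 * x) * (x powr (1 + e) * (1 - x) powr (1 + e)) \<le> (1 - 2 * x) * (x * (1 - x))"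
    using x by (intro mult_left_mono) auto
  also have "\<dots> < x"
  proof -
    have "(1 - 2 * x) * (x * (1 - x)) \<le> 1 * (x * (1 - x))" using x by (intro mult_right_mono) auto
    also have "\<dots> < x" using x by (simp add: algebra_simps)
    finally show ?thesis .
  qed
  finally show "0 < y" by (simp add: y_def)
  show "y \<le> x" using x by (simp add: y_def)
qed

text \<open>\<open>T\<close> is a scaled logarithm of \<open>(1 + r * z) / (1 - r * z)\<close> that
  takes -1 to 0 and 1 to 1. Since \<open>r < 1\<close>, it is smooth up to the circle, so the
  distance of \<open>T a\<close> from an end of the segment is at most a multiple of the distance of
  \<open>a\<close> from the circle.\<close>

lemma strip_map:
  assumes \<eta>: "\<eta> > 0"
  obtains T :: "complex \<Rightarrow> complex" and \<Lambda> where "T holomorphic_on ball 0 1" "\<Lambda> > 0"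
    "\<forall>z\<in>ball 0 1. 0 < Re (T z) \<and> Re (T z) < 1 \<and> \<bar>Im (T z)\<bar> < \<eta>"
    "\<forall>z. T (- z) = 1 - T z"
    "\<forall>x. 0 < x \<and> x \<le> 1 / 2 \<longrightarrow> (\<exists>a::real. \<bar>a\<bar> < 1 \<and> T (of_real a) = of_real x \<and> x \<le> \<Lambda> * (1 - \<bar>a\<bar>))"
proof -
  define A where "A = \<eta> / pi"
  have A: "A > 0" using \<eta> by (simp add: A_def)
  \<comment> \<open>\<open>E\<close> is the value of \<open>(1 + r) / (1 - r)\<close> for which
    \<open>T 1 = 1\<close>.\<close>
  define E where "E = exp (1 / (2 * A))"
  have E: "E > 1" using A by (simp add: E_def)
  define r where "r = (E - 1) / (E + 1)"
  have r: "0 < r" "r < 1" using E by (auto simp: r_def)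
  have "(1 + r) / (1 - r) = E" using E by (simp add: r_def field_simps)
  then have lnE: "ln (1 + r) - ln (1 - r) = 1 / (2 * A)"
    using r ln_div[of "1 + r" "1 - r"] by (simp add: E_def)
  define T where "T z = 1 / 2 + of_real A * (Ln (1 + of_real r * z) - Ln (1 - of_real r * z))" for z
  have pos: "0 < Re (1 + of_real r * z)" "0 < Re (1 - of_real r * z)" if "norm z \<le> 1" for z
  proof -
    have "\<bar>r * Re z\<bar> \<le> r" using that r abs_Re_le_cmod[of z] by (simp add: abs_mult mult_left_le)
    then show "0 < Re (1 + of_real r * z)" "0 < Re (1 - of_real r * z)" using r by simp_all
  qed
  \<comment> \<open>The restriction of \<open>T\<close> to the real diameter, end points
    included.\<close>
  define Tr where "Tr a = 1 / 2 + A * (ln (1 + r * a) - ln (1 - r * a))" for a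
  have posr: "0 < 1 + r * a" "0 < 1 - r * a" if "\<bar>a\<bar> \<le> 1" for a
  proof -
    have "\<bar>r * a\<bar> \<le> r" using that r by (simp add: abs_mult mult_left_le)
    then show "0 < 1 + r * a" "0 < 1 - r * a" using r by linarith+
  qed
  have TTr: "T (of_real a) = of_real (Tr a)" if "\<bar>a\<bar> \<le> 1" for a
    using Ln_of_real[OF posr(1)[OF that]] Ln_of_real[OF posr(2)[OF that]] by (simp add: T_def Tr_def)
  have Tr_minus: "Tr (- a) = 1 - Tr a" for a by (simp add: Tr_def algebra_simps)
  have Tr1: "Tr 1 = 1" using A by (simp add: Tr_def lnE)
  define \<Lambda> where "\<Lambda> = 2 * A / (1 - r)"
  have \<Lambda>: "\<Lambda> > 0" using A r by (simp add: \<Lambda>_def)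
  have lip: "1 - Tr a \<le> \<Lambda> * (1 - a)" if a: "\<bar>a\<bar> \<le> 1" for a
  proof -
    note p = posr[OF a]
    have ra: "1 - r \<le> 1 + r * a"
    proof -
      have "\<bar>r * a\<bar> \<le> r" using a r by (simp add: abs_mult mult_left_le)
      then show ?thesis by linarith
    qed
    have "ln (1 + r) - ln (1 + r * a) \<le> (1 + r - (1 + r * a)) / (1 + r * a)"
      using p r by (intro ln_diff_le) auto
    also have "\<dots> = r * (1 - a) / (1 + r * a)" by (simp add: algebra_simps)
    also have "\<dots> \<le> 1 * (1 - a) / (1 - r)"
      using ra r a by (intro frac_le mult_right_mono) auto
    finally have 1: "ln (1 + r) - ln (1 + r * a) \<le> (1 - a) / (1 - r)" by simp
    have "ln (1 - r * a) - ln (1 - r) \<le> (1 - r * a - (1 - r)) / (1 - r)"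
      using p r by (intro ln_diff_le) auto
    also have "\<dots> = r * (1 - a) / (1 - r)" by (simp add: algebra_simps)
    also have "\<dots> \<le> 1 * (1 - a) / (1 - r)"
      using r a by (intro divide_right_mono mult_right_mono) auto
    finally have 2: "ln (1 - r * a) - ln (1 - r) \<le> (1 - a) / (1 - r)" by simp
    have "1 - Tr a = Tr 1 - Tr a" by (simp add: Tr1)
    also have "\<dots> = A * ((ln (1 + r) - ln (1 + r * a)) + (ln (1 - r * a) - ln (1 - r)))"
      by (simp add: Tr_def algebra_simps)
    also have "\<dots> \<le> A * ((1 - a) / (1 - r) + (1 - a) / (1 - r))"
      using 1 2 A by (intro mult_left_mono add_mono) auto
    also have "\<dots> = \<Lambda> * (1 - a)" by (simp add: \<Lambda>_def)
    finally show ?thesis .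
  qed
  have T_minus: "T (- z) = 1 - T z" for z by (simp add: T_def algebra_simps)
  have Re_lt: "Re (T z) < 1" if z: "norm z < 1" for z
  proof -
    have nrz: "norm (of_real r * z) < r" using z r by (simp add: norm_mult)
    have p: "0 < Re (1 + of_real r * z)" "0 < Re (1 - of_real r * z)" using pos[of z] z by simp_all
    then have n0: "1 + of_real r * z \<noteq> 0" "1 - of_real r * z \<noteq> 0"
      by (metis less_irrefl zero_complex.sel(1))+
    have "norm (1 + of_real r * z) < 1 + r" using norm_triangle_ineq[of 1 "of_real r * z"] nrz by simp
    then have 1: "ln (norm (1 + of_real r * z)) < ln (1 + r)" using n0 r by (subst ln_less_cancel_iff) auto
    have "1 - r < norm (1 - of_real r * z)" using norm_triangle_ineq2[of 1 "of_real r * z"] nrz by simp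
    then have 2: "ln (1 - r) < ln (norm (1 - of_real r * z))" using n0 r by (subst ln_less_cancel_iff) auto
    \<comment> \<open>The real part depends on the two moduli only. The bound
      \<open>0 < Re (T z)\<close> will follow from this one by
      \<open>T (- z) = 1 - T z\<close>.\<close>
    have "Re (T z) = 1 / 2 + A * (ln (norm (1 + of_real r * z)) - ln (norm (1 - of_real r * z)))"
      using n0 by (simp add: T_def)
    also have "\<dots> < 1 / 2 + A * (1 / (2 * A))"
      using 1 2 lnE A by (intro add_strict_left_mono mult_strict_left_mono) linarith+
    also have "\<dots> = 1" using A by simp
    finally show ?thesis .
  qed
  show thesis
  proof
    show "T holomorphic_on ball 0 1" unfolding T_def
      using pos by (intro holomorphic_intros) (auto simp: complex_nonpos_Reals_iff less_imp_le not_le)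
    show "\<Lambda> > 0" by fact
    show "\<forall>z. T (- z) = 1 - T z" using T_minus by blast
  next
    show "\<forall>z\<in>ball 0 1. 0 < Re (T z) \<and> Re (T z) < 1 \<and> \<bar>Im (T z)\<bar> < \<eta>"
    proof
    fix z :: complex assume "z \<in> ball 0 1"
    then have z: "norm z < 1" by simp
    have p: "0 < Re (1 + of_real r * z)" "0 < Re (1 - of_real r * z)" using pos[of z] z by simp_all
    have "\<bar>Im (Ln (1 + of_real r * z)) - Im (Ln (1 - of_real r * z))\<bar> < pi"
      using Re_Ln_pos_lt_imp[OF p(1)] Re_Ln_pos_lt_imp[OF p(2)] by linarith
    moreover have "\<bar>Im (T z)\<bar> = A * \<bar>Im (Ln (1 + of_real r * z)) - Im (Ln (1 - of_real r * z))\<bar>"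
      using A by (simp add: T_def abs_mult)
    ultimately have "\<bar>Im (T z)\<bar> < A * pi" using A by simp
    then show "0 < Re (T z) \<and> Re (T z) < 1 \<and> \<bar>Im (T z)\<bar> < \<eta>"
      using Re_lt[OF z] Re_lt[of "- z"] z by (simp add: T_minus A_def)
    qed
  next
    show "\<forall>x. 0 < x \<and> x \<le> 1 / 2 \<longrightarrow>
      (\<exists>a::real. \<bar>a\<bar> < 1 \<and> T (of_real a) = of_real x \<and> x \<le> \<Lambda> * (1 - \<bar>a\<bar>))"
    proof (intro allI impI, elim conjE)
    fix x :: real assume x: "0 < x" "x \<le> 1 / 2"
    have "continuous_on {-1..1} Tr" unfolding Tr_def
      using posr by (intro continuous_intros) (auto simp: abs_le_iff less_imp_neq[symmetric])
    moreover have "Tr (- 1) = 0" using Tr_minus[of 1] Tr1 by simp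
    ultimately obtain a where a: "- 1 \<le> a" "a \<le> 1" "Tr a = x"
      using IVT'[of Tr "- 1" x 1] Tr1 x by auto
    have ab: "\<bar>a\<bar> \<le> 1" using a by auto
    have "1 - x \<le> \<Lambda> * (1 - a)" using lip[OF ab] a by simp
    moreover have "x \<le> \<Lambda> * (1 + a)" using lip[of "- a"] ab a Tr_minus[of a] by simp
    \<comment> \<open>For \<open>a \<ge> 0\<close> the first estimate suffices, because
      \<open>x \<le> 1 / 2\<close> gives \<open>x \<le> 1 - x\<close>.\<close>
    ultimately have le: "x \<le> \<Lambda> * (1 - \<bar>a\<bar>)" using x by (cases "a \<ge> 0") auto
    then have "\<bar>a\<bar> < 1" using x \<Lambda> by (smt (verit) mult_nonneg_nonpos)
    then show "\<exists>a::real. \<bar>a\<bar> < 1 \<and> T (of_real a) = of_real x \<and> x \<le> \<Lambda> * (1 - \<bar>a\<bar>)"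
      using le TTr[OF ab] a by auto
    qed
  qed
qed

text \<open>\<open>H\<close> is the cusp map after a map onto a subset of a thin strip. The
  constants \<open>c\<close> and \<open>\<rho>\<close> come from the cusp map alone and precede
  \<open>\<eta>\<close>; only the width of the strip, and with it \<open>l\<close>, depends on
  \<open>\<eta>\<close>. This order is needed because \<open>\<eta>\<close> will be chosen in terms
  of \<open>c\<close> and \<open>\<rho>\<close>.\<close>

lemma model_disc:
  assumes e: "0 < e" "e \<le> 1 / 2" and s0: "0 < s0" "s0 \<le> 1 / 2"
  obtains c \<rho> where "c > 0" "0 < \<rho>"
    "\<And>\<eta>. \<eta> > 0 \<Longrightarrow> \<exists>H l. l > 0 \<and> H holomorphic_on ball 0 1 \<and>
      (\<forall>z\<in>ball 0 1.
        (norm (H z) \<le> s0 \<and> 0 < Re (H z) \<and> c * norm (H z) powr (1 + e) \<le> Re (H z)) \<or>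
        (norm (1 - H z) \<le> s0 \<and> 0 < Re (1 - H z) \<and> c * norm (1 - H z) powr (1 + e) \<le> Re (1 - H z)) \<or>
        (\<exists>y\<in>{\<rho>..1 - \<rho>}. dist (H z) (of_real y) < \<eta>)) \<and>
      (\<forall>s. 0 < s \<longrightarrow> s \<le> s0 \<longrightarrow>
        (\<exists>a::real. \<bar>a\<bar> < 1 \<and> H (of_real a) = of_real s \<and> l * s \<le> 1 - \<bar>a\<bar>) \<and>
        (\<exists>a::real. \<bar>a\<bar> < 1 \<and> H (of_real a) = of_real (1 - s) \<and> l * s \<le> 1 - \<bar>a\<bar>))"
proof -
  let ?h = "cusp_map e"
  define hr where "hr x = x - (1 - 2 * x) * (x powr (1 + e) * (1 - x) powr (1 + e))" for x :: real
  have hr: "?h (of_real x) = of_real (hr x)" if "0 < x" "x < 1" for x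
    using cusp_map_of_real[OF that] by (simp add: hr_def)
  have hr_reflect: "hr (1 - x) = 1 - hr x" for x by (simp add: hr_def algebra_simps)
  have hr_bounds: "0 < hr x" "hr x \<le> x" if "0 < x" "x \<le> 1 / 2" for x
    using cusp_map_real_bounds[OF e(1) that] by (auto simp: hr_def)
  have hr01: "0 < hr x \<and> hr x < 1" if "0 < x" "x < 1" for x
  proof (cases "x \<le> 1 / 2")
    case True
    then show ?thesis using hr_bounds[of x] that by linarith
  next
    case False
    then show ?thesis using hr_bounds[of "1 - x"] hr_reflect[of x] that by simp
  qed
  have cont_hr: "continuous_on {0<..<1} hr" unfolding hr_def by (intro continuous_intros) auto
  obtain \<rho>1 c where \<rho>1: "\<rho>1 > 0" and c: "c > 0" and
    near: "\<And>z. 0 < Re z \<Longrightarrow> norm z \<le> \<rho>1 \<Longrightarrow> norm (?h z) \<le> s0 \<and> 0 < Re (?h z) \<and>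
       c * norm (?h z) powr (1 + e) \<le> Re (?h z)"
    using cusp_map_near_0[OF e s0(1)] by blast
  \<comment> \<open>In a strip with \<open>\<bar>Im t\<bar> < d\<close>, a point with
    \<open>Re t < d\<close> is within \<open>2 * d \<le> \<rho>1\<close> of 0, and similarly at 1;
    all other points have real part in \<open>{d..1 - d}\<close>.\<close>
  define d where "d = min (\<rho>1 / 2) (1 / 4)"
  have d: "0 < d" "d \<le> 1 / 4" "2 * d \<le> \<rho>1" using \<rho>1 by (auto simp: d_def)
  have ne: "{d..1 - d} \<noteq> {}" using d by auto
  have sub: "{d..1 - d} \<subseteq> {0<..<1}" using d by auto
  obtain x0 where x0: "x0 \<in> {d..1 - d}" "\<And>y. y \<in> {d..1 - d} \<Longrightarrow> hr x0 \<le> hr y"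
    using continuous_attains_inf[OF _ ne continuous_on_subset[OF cont_hr sub]] by blast
  define \<rho> where "\<rho> = hr x0"
  have \<rho>: "\<rho> > 0" using hr01[of x0] x0(1) d by (auto simp: \<rho>_def)
  have mid: "hr x \<in> {\<rho>..1 - \<rho>}" if "x \<in> {d..1 - d}" for x
    using x0(2)[OF that] x0(2)[of "1 - x"] that hr_reflect[of x] by (auto simp: \<rho>_def)
  \<comment> \<open>A compact part of the domain of the cusp map, where uniform continuity turns a
    thin strip into a thin image.\<close>
  define S where "S = cbox (Complex d (- 1)) (Complex (1 - d) 1)"
  have S_iff: "z \<in> S \<longleftrightarrow> d \<le> Re z \<and> Re z \<le> 1 - d \<and> \<bar>Im z\<bar> \<le> 1" for z
    unfolding S_def in_cbox_complex_iff by (simp add: abs_le_iff) linarith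
  have "continuous_on S ?h"
    by (rule holomorphic_on_imp_continuous_on, rule holomorphic_on_subset[OF holomorphic_on_cusp_map])
      (use d in \<open>auto simp: S_iff\<close>)
  then have uc: "uniformly_continuous_on S ?h"
    by (intro compact_uniformly_continuous) (auto simp: S_def)
  show thesis
  proof
    show "c > 0" "\<rho> > 0" by fact+
    fix \<eta> :: real assume \<eta>: "\<eta> > 0"
    obtain \<eta>1 where \<eta>1: "\<eta>1 > 0" "\<And>z w. z \<in> S \<Longrightarrow> w \<in> S \<Longrightarrow> dist w z < \<eta>1 \<Longrightarrow> dist (?h w) (?h z) < \<eta>"
      using uc[unfolded uniformly_continuous_on_def, rule_format, OF \<eta>] by blast
    define \<eta>2 where "\<eta>2 = min \<eta>1 d"
    have \<eta>2: "\<eta>2 > 0" using \<eta>1 d by (simp add: \<eta>2_def)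
    obtain T and \<Lambda> :: real where T: "T holomorphic_on ball 0 1" "\<Lambda> > 0"
      and Tz': "\<forall>z\<in>ball 0 1. 0 < Re (T z) \<and> Re (T z) < 1 \<and> \<bar>Im (T z)\<bar> < \<eta>2"
      and Tm: "\<forall>z. T (- z) = 1 - T z"
      and Ta: "\<forall>x. 0 < x \<and> x \<le> 1 / 2 \<longrightarrow>
        (\<exists>a::real. \<bar>a\<bar> < 1 \<and> T (of_real a) = of_real x \<and> x \<le> \<Lambda> * (1 - \<bar>a\<bar>))"
      by (rule strip_map[OF \<eta>2])
    note Tz = bspec[OF Tz']
    define H where "H z = ?h (T z)" for z
    have Hm: "H (- z) = 1 - H z" for z by (simp add: H_def Tm cusp_map_reflect)
    show "\<exists>H l. l > 0 \<and> H holomorphic_on ball 0 1 \<and>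
      (\<forall>z\<in>ball 0 1.
        (norm (H z) \<le> s0 \<and> 0 < Re (H z) \<and> c * norm (H z) powr (1 + e) \<le> Re (H z)) \<or>
        (norm (1 - H z) \<le> s0 \<and> 0 < Re (1 - H z) \<and> c * norm (1 - H z) powr (1 + e) \<le> Re (1 - H z)) \<or>
        (\<exists>y\<in>{\<rho>..1 - \<rho>}. dist (H z) (of_real y) < \<eta>)) \<and>
      (\<forall>s. 0 < s \<longrightarrow> s \<le> s0 \<longrightarrow>
        (\<exists>a::real. \<bar>a\<bar> < 1 \<and> H (of_real a) = of_real s \<and> l * s \<le> 1 - \<bar>a\<bar>) \<and>
        (\<exists>a::real. \<bar>a\<bar> < 1 \<and> H (of_real a) = of_real (1 - s) \<and> l * s \<le> 1 - \<bar>a\<bar>))"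
    proof (rule exI[of _ H], rule exI[of _ "1 / \<Lambda>"], intro conjI ballI allI impI)
      show "1 / \<Lambda> > 0" using T by simp
      have "?h \<circ> T holomorphic_on ball 0 1"
        by (rule holomorphic_on_compose_gen[OF T(1) holomorphic_on_cusp_map]) (use Tz in blast)
      moreover have "H = ?h \<circ> T" by (simp add: H_def fun_eq_iff)
      ultimately show "H holomorphic_on ball 0 1" by simp
    next
      fix z :: complex assume z: "z \<in> ball 0 1"
      let ?t = "T z"
      note t = Tz[OF z]
      have md: "norm ?t \<le> \<bar>Re ?t\<bar> + \<bar>Im ?t\<bar>" "norm (1 - ?t) \<le> \<bar>1 - Re ?t\<bar> + \<bar>Im ?t\<bar>"
        using cmod_le[of ?t] cmod_le[of "1 - ?t"] by auto
      consider "norm ?t \<le> \<rho>1" | "norm (1 - ?t) \<le> \<rho>1" | "norm ?t > \<rho>1" "norm (1 - ?t) > \<rho>1" by linarith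
      then show "(norm (H z) \<le> s0 \<and> 0 < Re (H z) \<and> c * norm (H z) powr (1 + e) \<le> Re (H z)) \<or>
        (norm (1 - H z) \<le> s0 \<and> 0 < Re (1 - H z) \<and> c * norm (1 - H z) powr (1 + e) \<le> Re (1 - H z)) \<or>
        (\<exists>y\<in>{\<rho>..1 - \<rho>}. dist (H z) (of_real y) < \<eta>)"
      proof cases
        case 1
        then show ?thesis using near[of ?t] t by (simp add: H_def)
      next
        case 2
        then show ?thesis using near[of "1 - ?t"] t by (simp add: H_def cusp_map_reflect)
      next
        case 3
        have x: "Re ?t \<in> {d..1 - d}" using 3 md t d by (auto simp: \<eta>2_def)
        have "dist ?t (of_real (Re ?t)) = \<bar>Im ?t\<bar>"
          by (simp add: dist_norm complex_eq_iff cmod_def)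
        then have "dist (?h ?t) (?h (of_real (Re ?t))) < \<eta>"
          using x t d by (intro \<eta>1(2)) (auto simp: \<eta>2_def S_iff)
        then have "dist (H z) (of_real (hr (Re ?t))) < \<eta>" using hr[of "Re ?t"] t by (simp add: H_def)
        then show ?thesis using mid[OF x] by blast
      qed
    next
      fix s :: real assume s: "0 < s" "s \<le> s0"
      have "continuous_on {s..1 / 2} hr"
        by (rule continuous_on_subset[OF cont_hr]) (use s in auto)
      moreover have "hr s \<le> s" using hr_bounds[of s] s s0 by auto
      moreover have "hr (1 / 2) = 1 / 2" by (simp add: hr_def)
      \<comment> \<open>That the preimage satisfies \<open>x \<ge> s\<close> transfers the linear
        rate of \<open>T\<close> to \<open>H\<close>.\<close>
      ultimately obtain x where x: "s \<le> x" "x \<le> 1 / 2" "hr x = s"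
        using IVT'[of hr s s "1 / 2"] s s0 by auto
      obtain a :: real where a: "\<bar>a\<bar> < 1" "T (of_real a) = of_real x" "x \<le> \<Lambda> * (1 - \<bar>a\<bar>)"
        using Ta x s by (metis less_le_trans)
      have Ha: "H (of_real a) = of_real s" using hr[of x] x s by (simp add: H_def a)
      have la: "1 / \<Lambda> * s \<le> 1 - \<bar>a\<bar>" using a(3) x(1) T(2) by (simp add: field_simps)
      show "\<exists>a::real. \<bar>a\<bar> < 1 \<and> H (of_real a) = of_real s \<and> 1 / \<Lambda> * s \<le> 1 - \<bar>a\<bar>"
        using a(1) Ha la by blast
      \<comment> \<open>By symmetry the point over \<open>1 - s\<close> is the negative of the point
        over \<open>s\<close>.\<close>
      have "H (of_real (- a)) = of_real (1 - s)" using Hm[of "of_real a"] Ha by simp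
      then show "\<exists>a::real. \<bar>a\<bar> < 1 \<and> H (of_real a) = of_real (1 - s) \<and> 1 / \<Lambda> * s \<le> 1 - \<bar>a\<bar>"
        using a(1) la by (intro exI[of _ "- a"]) simp
    qed
  qed
qed

text \<open>A disc automorphism taking 0 to \<open>a\<close> and \<open>\<bar>c\<bar>\<close> to
  \<open>b\<close> is composed with \<open>\<phi>\<close>, where \<open>\<bar>c\<bar>\<close> is the
  pseudohyperbolic distance of \<open>a\<close> and \<open>b\<close>. The estimate comes from
  \<open>1 - c = (1 + a) * (1 - b) / (1 - a * b)\<close>, the analogous formula for
  \<open>1 + c\<close>, and \<open>1 - a * b \<le> 2\<close>.\<close>

lemma lempert_le_real_points:
  assumes \<phi>: "\<phi> \<in> hol_discs D" and a: "\<bar>a\<bar> < 1" "\<phi> (of_real a) = z" and b: "\<bar>b\<bar> < 1" "\<phi> (of_real b) = w"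
  shows "lempert D z w \<le> 1 - (1 - \<bar>a\<bar>) * (1 - \<bar>b\<bar>) / 2"
proof -
  define c where "c = (b - a) / (1 - a * b)"
  have ab: "\<bar>a * b\<bar> < 1" using abs_mult_less[OF a(1) b(1)] by (simp add: abs_mult)
  then have d: "1 - a * b > 0" "1 - a * b \<le> 2" by auto
  have c1: "\<bar>c\<bar> \<le> 1 - (1 - \<bar>a\<bar>) * (1 - \<bar>b\<bar>) / 2"
  proof -
    have *: "(1 - \<bar>a\<bar>) * (1 - \<bar>b\<bar>) / 2 \<le> x * y / (1 - a * b)"
      if "1 - \<bar>a\<bar> \<le> x" "1 - \<bar>b\<bar> \<le> y" for x y
      using that a b d by (intro frac_le mult_mono mult_nonneg_nonneg) auto
    have "1 - c = ((1 - a * b) - (b - a)) / (1 - a * b)" "1 + c = ((1 - a * b) + (b - a)) / (1 - a * b)"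
      using d unfolding c_def by (simp_all add: diff_divide_distrib add_divide_distrib)
    then have "1 - c = (1 + a) * (1 - b) / (1 - a * b)" "1 + c = (1 - a) * (1 + b) / (1 - a * b)"
      by (simp_all add: algebra_simps)
    moreover have "(1 - \<bar>a\<bar>) * (1 - \<bar>b\<bar>) / 2 \<le> (1 + a) * (1 - b) / (1 - a * b)"
      "(1 - \<bar>a\<bar>) * (1 - \<bar>b\<bar>) / 2 \<le> (1 - a) * (1 + b) / (1 - a * b)"
      by (rule *; simp)+
    ultimately show ?thesis by linarith
  qed
  have "0 < (1 - \<bar>a\<bar>) * (1 - \<bar>b\<bar>) / 2" using a b by simp
  then have c_lt: "\<bar>c\<bar> < 1" using c1 by linarith
  \<comment> \<open>The Lempert function asks for a nonnegative parameter, so the disc is turned by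
    the sign of \<open>c\<close>.\<close>
  define \<sigma> where "\<sigma> = (if c \<ge> 0 then 1 else - 1 :: real)"
  have \<sigma>: "\<sigma> * \<bar>c\<bar> = c" "\<bar>\<sigma>\<bar> = 1" by (auto simp: \<sigma>_def)
  define M where "M u = (of_real \<sigma> * u + of_real a) / (1 + of_real a * (of_real \<sigma> * u))" for u :: complex
  have nz: "1 + of_real a * (of_real \<sigma> * u) \<noteq> 0" if "norm u < 1" for u :: complex
  proof
    assume "1 + of_real a * (of_real \<sigma> * u) = 0"
    then have "norm (of_real a * (of_real \<sigma> * u)) = 1"
      by (metis add_eq_0_iff norm_minus_cancel norm_one)
    then have "\<bar>a\<bar> * norm u = 1" using \<sigma> by (simp add: norm_mult)
    moreover have "\<bar>a\<bar> * norm u \<le> \<bar>a\<bar>" using that by (simp add: mult_left_le)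
    ultimately show False using a(1) by linarith
  qed
  have M1: "norm (M u) < 1" if u: "norm u < 1" for u
  proof -
    let ?v = "of_real \<sigma> * u"
    have v: "norm ?v < 1" using u \<sigma> by (simp add: norm_mult)
    have "(norm (1 + of_real a * ?v))\<^sup>2 - (norm (?v + of_real a))\<^sup>2 = (1 - a\<^sup>2) * (1 - (norm ?v)\<^sup>2)"
      unfolding cmod_power2 by (simp add: power2_eq_square algebra_simps)
    moreover have "a\<^sup>2 < 1" using a(1) by (simp add: abs_square_less_1)
    moreover have "(norm ?v)\<^sup>2 < 1" using v by (simp add: abs_square_less_1)
    ultimately have "0 < (norm (1 + of_real a * ?v))\<^sup>2 - (norm (?v + of_real a))\<^sup>2"
      by simp
    then have "(norm (?v + of_real a))\<^sup>2 < (norm (1 + of_real a * ?v))\<^sup>2" by linarith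
    then have "norm (?v + of_real a) < norm (1 + of_real a * ?v)"
      by (rule power2_less_imp_less) simp
    then show ?thesis using nz[OF u] by (simp add: M_def norm_divide)
  qed
  have M_hol: "M holomorphic_on ball 0 1"
    unfolding M_def using nz by (intro holomorphic_intros) auto
  have M_ball: "M ` ball 0 1 \<subseteq> ball 0 1" using M1 by auto
  have "(\<lambda>u. \<phi> (M u)) \<in> hol_discs D"
    unfolding hol_discs_def
  proof (intro CollectI conjI allI)
    fix i
    have "(\<lambda>u. \<phi> u $ i) holomorphic_on ball 0 1" using \<phi> by (simp add: hol_discs_def)
    from holomorphic_on_compose_gen[OF M_hol this M_ball]
    show "(\<lambda>u. \<phi> (M u) $ i) holomorphic_on ball 0 1" by (simp add: comp_def)
    have "\<phi> ` ball 0 1 \<subseteq> D" using \<phi> by (simp add: hol_discs_def)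
    then show "(\<lambda>u. \<phi> (M u)) ` ball 0 1 \<subseteq> D" using M_ball by blast
  qed
  moreover have "M 0 = of_real a" by (simp add: M_def)
  moreover have "M (of_real \<bar>c\<bar>) = of_real b"
  proof -
    have "M (of_real \<bar>c\<bar>) = of_real ((\<sigma> * \<bar>c\<bar> + a) / (1 + a * (\<sigma> * \<bar>c\<bar>)))" by (simp add: M_def)
    also have "(\<sigma> * \<bar>c\<bar> + a) / (1 + a * (\<sigma> * \<bar>c\<bar>)) = b"
    proof -
      have "c + a = b * (1 - a\<^sup>2) / (1 - a * b)" "1 + a * c = (1 - a\<^sup>2) / (1 - a * b)"
        using d by (auto simp: c_def field_simps power2_eq_square)
      moreover have "1 - a\<^sup>2 \<noteq> 0" using a(1) by (simp add: abs_square_eq_1)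
      ultimately show ?thesis unfolding \<sigma> using d by simp
    qed
    finally show ?thesis .
  qed
  ultimately have "lempert D z w \<le> \<bar>c\<bar>"
    unfolding lempert_def using a b c_lt
    by (intro cInf_lower bdd_belowI[of _ 0]) (auto intro!: bexI[of _ "\<lambda>u. \<phi> (M u)"])
  then show ?thesis using c1 by linarith
qed

section \<open>The upper bound\<close>

text \<open>The path runs along the segment from \<open>p\<close>, then along \<open>G\<close> at
  triple speed, then along the segment to \<open>p'\<close>, each on a third of the interval. Away
  from the ends the clearance on the segments is at least
  \<open>\<kappa> * \<rho> / 2\<close>.\<close>

lemma joining_path:
  fixes D :: "'a::real_normed_vector set" and G :: "real \<Rightarrow> 'a"
  assumes R: "norm V \<le> R" "norm V' \<le> R" and \<rho>: "\<rho> > 0" and \<kappa>: "\<kappa> > 0"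
    and ball0: "\<And>y. 0 < y \<Longrightarrow> y \<le> 1 / 3 \<Longrightarrow> ball (p + y *\<^sub>R V) (\<kappa> * y / 2) \<subseteq> D"
    and ball1: "\<And>y. 0 < y \<Longrightarrow> y \<le> 1 / 3 \<Longrightarrow> ball (p' + y *\<^sub>R V') (\<kappa> * y / 2) \<subseteq> D"
    and G: "L-lipschitz_on {0..1} G" "G 0 = p + (1 / 3) *\<^sub>R V" "G 1 = p' + (1 / 3) *\<^sub>R V'"
      "\<And>x. x \<in> {0..1} \<Longrightarrow> ball (G x) \<delta> \<subseteq> D"
  obtains f where "(max R (3 * L))-lipschitz_on {0..1} f"
    "\<And>y. 0 \<le> y \<Longrightarrow> y \<le> 1 / 3 \<Longrightarrow> f y = p + y *\<^sub>R V"
    "\<And>y. 0 \<le> y \<Longrightarrow> y \<le> 1 / 3 \<Longrightarrow> f (1 - y) = p' + y *\<^sub>R V'"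
    "\<And>y. \<rho> \<le> y \<Longrightarrow> y \<le> 1 - \<rho> \<Longrightarrow> ball (f y) (min (\<kappa> * \<rho> / 2) \<delta>) \<subseteq> D"
proof -
  define g where "g y = (if y \<le> 2 / 3 then G (3 * y - 1) else p' + (1 - y) *\<^sub>R V')" for y
  define f where "f y = (if y \<le> 1 / 3 then p + y *\<^sub>R V else g y)" for y
  have R0: "R \<ge> 0" using R(1) norm_ge_zero order_trans by blast
  have L0: "L \<ge> 0" using G(1) by (rule lipschitz_on_nonneg)
  have l0: "(max R (3 * L))-lipschitz_on {0..1 / 3} (\<lambda>y. p + y *\<^sub>R V)"
  proof (rule lipschitz_onI)
    fix x y :: real
    have "dist (p + x *\<^sub>R V) (p + y *\<^sub>R V) = \<bar>x - y\<bar> * norm V"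
      by (simp add: dist_norm flip: scaleR_diff_left)
    also have "\<dots> \<le> \<bar>x - y\<bar> * max R (3 * L)" using R by (intro mult_left_mono) auto
    finally show "dist (p + x *\<^sub>R V) (p + y *\<^sub>R V) \<le> max R (3 * L) * dist x y"
      by (simp add: dist_real_def mult.commute)
  qed (use R0 in auto)
  have l1: "(max R (3 * L))-lipschitz_on {1 / 3..2 / 3} (\<lambda>y. G (3 * y - 1))"
  proof (rule lipschitz_onI)
    fix x y :: real assume "x \<in> {1 / 3..2 / 3}" "y \<in> {1 / 3..2 / 3}"
    then have "dist (G (3 * x - 1)) (G (3 * y - 1)) \<le> L * dist (3 * x - 1) (3 * y - 1)"
      by (intro lipschitz_onD[OF G(1)]) auto
    also have "dist (3 * x - 1) (3 * y - 1) = 3 * dist x y" by (simp add: dist_real_def abs_if)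
    also have "L * (3 * dist x y) \<le> max R (3 * L) * dist x y"
      using mult_right_mono[of "3 * L" "max R (3 * L)" "dist x y"] by simp
    finally show "dist (G (3 * x - 1)) (G (3 * y - 1)) \<le> max R (3 * L) * dist x y" .
  qed (use R0 in auto)
  have l2: "(max R (3 * L))-lipschitz_on {2 / 3..1} (\<lambda>y. p' + (1 - y) *\<^sub>R V')"
  proof (rule lipschitz_onI)
    fix x y :: real
    have "p' + (1 - x) *\<^sub>R V' - (p' + (1 - y) *\<^sub>R V') = (y - x) *\<^sub>R V'" by (simp add: algebra_simps)
    then have "dist (p' + (1 - x) *\<^sub>R V') (p' + (1 - y) *\<^sub>R V') = \<bar>x - y\<bar> * norm V'"
      by (simp add: dist_norm abs_minus_commute)
    also have "\<dots> \<le> \<bar>x - y\<bar> * max R (3 * L)" using R by (intro mult_left_mono) auto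
    finally show "dist (p' + (1 - x) *\<^sub>R V') (p' + (1 - y) *\<^sub>R V') \<le> max R (3 * L) * dist x y"
      by (simp add: dist_real_def mult.commute)
  qed (use R0 in auto)
  have "(max R (3 * L))-lipschitz_on {1 / 3..1} g"
    unfolding g_def by (rule lipschitz_on_concat[OF l1 l2]) (simp add: G)
  then have lf: "(max R (3 * L))-lipschitz_on {0..1} f"
    unfolding f_def by (rule lipschitz_on_concat[OF l0]) (simp add: g_def G)
  have f0: "f y = p + y *\<^sub>R V" if "y \<le> 1 / 3" for y using that by (simp add: f_def)
  have f1: "f (1 - y) = p' + y *\<^sub>R V'" if "y \<le> 1 / 3" for y
  proof (cases "y = 1 / 3")
    case True
    \<comment> \<open>At 2/3 the definition still takes the branch of \<open>G\<close>, whose end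
      value agrees with the last segment.\<close>
    have "f (2 / 3) = p' + (1 / 3) *\<^sub>R V'" by (simp add: f_def g_def G)
    then show ?thesis unfolding True by simp
  next
    case False
    then show ?thesis using that by (simp add: f_def g_def)
  qed
  have "ball (f y) (min (\<kappa> * \<rho> / 2) \<delta>) \<subseteq> D" if y: "\<rho> \<le> y" "y \<le> 1 - \<rho>" for y
  proof -
    consider "y \<le> 1 / 3" | "1 / 3 < y" "y \<le> 2 / 3" | "2 / 3 < y" by linarith
    then show ?thesis
    proof cases
      case 1
      have "\<kappa> * \<rho> / 2 \<le> \<kappa> * y / 2" using y \<kappa> by simp
      then have "min (\<kappa> * \<rho> / 2) \<delta> \<le> \<kappa> * y / 2" by (rule min.coboundedI1)
      then show ?thesis
        using ball0[of y] 1 y \<rho> f0[OF 1] subset_ball by (metis less_le_trans subset_trans)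
    next
      case 2
      then have "f y = G (3 * y - 1)" by (simp add: f_def g_def)
      moreover have "ball (G (3 * y - 1)) \<delta> \<subseteq> D" using 2 by (intro G) auto
      ultimately show ?thesis using subset_ball[of "min (\<kappa> * \<rho> / 2) \<delta>" \<delta>] by auto
    next
      case 3
      define t where "t = 1 - y"
      have t: "\<rho> \<le> t" "0 < t" "t \<le> 1 / 3" "y = 1 - t" using 3 y \<rho> by (auto simp: t_def)
      have "\<kappa> * \<rho> / 2 \<le> \<kappa> * t / 2" using t \<kappa> by simp
      then have "min (\<kappa> * \<rho> / 2) \<delta> \<le> \<kappa> * t / 2" by (rule min.coboundedI1)
      then show ?thesis
        using ball1[OF t(2,3)] f1[OF t(3)] t(4) subset_ball by (metis subset_trans)
    qed
  qed
  then show thesis using that[OF lf] f0 f1 by blast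
qed

text \<open>At a real parameter \<open>u = y\<close>, the term with \<open>c \<le> 1 / 2\<close>
  uses at most half of \<open>\<kappa> * y\<close>; the rest is left for the perturbation
  \<open>q\<close>.\<close>

lemma germ_ball:
  fixes p V :: "complex ^ 'n"
  assumes germ: "\<And>u q. norm u \<le> 1 \<Longrightarrow> norm q + c * \<kappa> * norm u powr (1 + e) < \<kappa> * Re u \<Longrightarrow>
      p + u *s V + q \<in> D"
    and e: "e > 0" and c: "0 < c" "c \<le> 1 / 2" and \<kappa>: "\<kappa> > 0" and y: "0 < y" "y \<le> 1"
  shows "ball (p + y *\<^sub>R V) (\<kappa> * y / 2) \<subseteq> D"
proof
  fix x assume x: "x \<in> ball (p + y *\<^sub>R V) (\<kappa> * y / 2)"
  let ?q = "x - (p + y *\<^sub>R V)"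
  have "y powr (1 + e) \<le> y powr 1" using y e by (intro powr_mono') auto
  then have "c * \<kappa> * y powr (1 + e) \<le> 1 / 2 * \<kappa> * y"
    using c \<kappa> y by (intro mult_mono) auto
  moreover have "norm ?q < \<kappa> * y / 2" using x by (simp add: dist_norm norm_minus_commute)
  ultimately have "p + of_real y *s V + ?q \<in> D" using y by (intro germ) auto
  then show "x \<in> D" by (simp add: of_real_vector_scalar_mult)
qed

text \<open>In the cusp, \<open>\<kappa> * Re u\<close> is at least
  \<open>\<kappa> * c2 * norm u powr (1 + e)\<close>. The germ condition uses at most half of this,
  and the error of \<open>P\<close> at most a quarter because
  \<open>(norm u)\<^sup>2 \<le> norm u powr (1 + e)\<close>.\<close>

lemma germ_cusp:
  fixes p V :: "complex ^ 'n"
  assumes germ: "\<And>u q. norm u \<le> 1 \<Longrightarrow> norm q + c * \<kappa> * norm u powr (1 + e) < \<kappa> * Re u \<Longrightarrow>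
      p + u *s V + q \<in> D"
    and e: "0 < e" "e \<le> 1" and c: "c \<le> c2 / 2" "c2 > 0" and \<kappa>: "\<kappa> > 0" and \<delta>: "\<delta> \<le> \<kappa> * c2 / 4"
    and u: "norm u \<le> 1" "0 < Re u" "c2 * norm u powr (1 + e) \<le> Re u"
    and P: "norm (x - (p + u *s V)) \<le> \<delta> * (norm u)\<^sup>2"
  shows "x \<in> D"
proof -
  have nu: "norm u > 0" using u(2) by auto
  have "(norm u)\<^sup>2 = norm u powr 2" using nu by simp
  also have "\<dots> \<le> norm u powr (1 + e)" using u nu e by (intro powr_mono') auto
  finally have "\<delta> * (norm u)\<^sup>2 \<le> \<kappa> * c2 / 4 * norm u powr (1 + e)"
    using \<delta> \<kappa> c by (intro mult_mono) auto
  moreover have "c * \<kappa> * norm u powr (1 + e) \<le> c2 / 2 * \<kappa> * norm u powr (1 + e)"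
    using c \<kappa> by (intro mult_right_mono) auto
  moreover have "0 < \<kappa> * (c2 * norm u powr (1 + e))" using \<kappa> c nu by simp
  moreover have "\<kappa> * (c2 * norm u powr (1 + e)) \<le> \<kappa> * Re u" using u \<kappa> by simp
  ultimately have "norm (x - (p + u *s V)) + c * \<kappa> * norm u powr (1 + e) < \<kappa> * Re u"
    using P by (simp add: algebra_simps)
  then have "p + u *s V + (x - (p + u *s V)) \<in> D" by (rule germ[OF u(1)])
  then show ?thesis by simp
qed

theorem theorem1:
  fixes D :: "(complex ^ 'n) set" and \<epsilon> :: real
  assumes "\<epsilon> > 0"
    and "is_domain D"
    and "bounded D"
    and "C1_plus_smooth \<epsilon> D"
  shows "\<exists>c>0. \<forall>z\<in>D. \<forall>w\<in>D. lempert D z w \<le> 1 - c * bdist D z * bdist D w"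
proof -
  \<comment> \<open>Lowering the exponent to at most 1/2 meets the requirement of the model disc;
    the boundary germs allow any smaller exponent.\<close>
  define e where "e = min \<epsilon> (1 / 2)"
  have e: "0 < e" "e \<le> 1 / 2" "e \<le> \<epsilon>" "e \<le> 1" using assms(1) by (auto simp: e_def)
  let ?s0 = "1 / 128 :: real"
  have s0: "0 < ?s0" "?s0 \<le> 1 / 2" "?s0 \<le> 1" by auto
  obtain c2 \<rho> where c2: "c2 > 0" and \<rho>: "0 < \<rho>" and model: "\<And>\<eta>. \<eta> > 0 \<Longrightarrow> \<exists>H l. l > 0 \<and> H holomorphic_on ball 0 1 \<and>
      (\<forall>z\<in>ball 0 1.
        (norm (H z) \<le> ?s0 \<and> 0 < Re (H z) \<and> c2 * norm (H z) powr (1 + e) \<le> Re (H z)) \<or>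
        (norm (1 - H z) \<le> ?s0 \<and> 0 < Re (1 - H z) \<and> c2 * norm (1 - H z) powr (1 + e) \<le> Re (1 - H z)) \<or>
        (\<exists>y\<in>{\<rho>..1 - \<rho>}. dist (H z) (of_real y) < \<eta>)) \<and>
      (\<forall>s. 0 < s \<longrightarrow> s \<le> ?s0 \<longrightarrow>
        (\<exists>a::real. \<bar>a\<bar> < 1 \<and> H (of_real a) = of_real s \<and> l * s \<le> 1 - \<bar>a\<bar>) \<and>
        (\<exists>a::real. \<bar>a\<bar> < 1 \<and> H (of_real a) = of_real (1 - s) \<and> l * s \<le> 1 - \<bar>a\<bar>))"
    using model_disc[OF e(1,2) s0(1,2)] by blast
  \<comment> \<open>The bound \<open>c2 / 2\<close> is for \<open>germ_cusp\<close>, the bound 1/2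
    for \<open>germ_ball\<close>.\<close>
  define c where "c = min (c2 / 2) (1 / 2)"
  have c: "0 < c" "c \<le> 1 / 2" "c \<le> c2 / 2" using c2 by (auto simp: c_def)
  obtain \<kappa> \<kappa>' R where \<kappa>: "\<kappa> > 0" and \<kappa>': "\<kappa>' > 0" and
    germ: "\<And>z. z \<in> D \<Longrightarrow> \<exists>p V s. z = p + s *\<^sub>R V \<and> 0 < s \<and> s \<le> ?s0 \<and> \<kappa>' * bdist D z \<le> s \<and>
       norm p \<le> R \<and> norm V \<le> R \<and>
       (\<forall>u q. norm u \<le> 1 \<longrightarrow> norm q + c * \<kappa> * norm u powr (1 + e) < \<kappa> * Re u \<longrightarrow> p + u *s V + q \<in> D)"
    using boundary_germ[OF e(1) e(4) e(3) assms(2-4) c(1) s0(1,3)] by blast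
  \<comment> \<open>The clearance given by \<open>germ_ball\<close> at \<open>y = 1 / 3\<close>,
    where the joining paths start and end.\<close>
  have \<kappa>6: "\<kappa> / 6 > 0" using \<kappa> by simp
  have D: "open D" "connected D" using assms(2) by (auto simp: is_domain_def)
  obtain L \<delta>p where \<delta>p: "\<delta>p > 0" and paths: "\<forall>q q'. ball q (\<kappa> / 6) \<subseteq> D \<longrightarrow> ball q' (\<kappa> / 6) \<subseteq> D \<longrightarrow>
      (\<exists>G :: real \<Rightarrow> complex ^ 'n. L-lipschitz_on {0..1} G \<and> G 0 = q \<and> G 1 = q' \<and>
        (\<forall>x\<in>{0..1}. ball (G x) \<delta>p \<subseteq> D))"
    by (rule lipschitz_paths[OF D assms(3) \<kappa>6])
  define \<delta> where "\<delta> = min (min (\<kappa> * \<rho> / 2) \<delta>p) (\<kappa> * c2 / 4)"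
  have \<delta>: "\<delta> > 0" "\<delta> \<le> min (\<kappa> * \<rho> / 2) \<delta>p" "\<delta> \<le> \<kappa> * c2 / 4"
    using \<kappa> \<rho> \<delta>p c2 by (auto simp: \<delta>_def)
  obtain \<eta> where \<eta>: "\<eta> > 0" and path: "\<forall>(p :: complex ^ 'n) V p' V' (s :: real) (s' :: real) f.
      norm p \<le> R \<longrightarrow> norm V \<le> R \<longrightarrow> norm p' \<le> R \<longrightarrow> norm V' \<le> R \<longrightarrow>
      0 < s \<longrightarrow> s \<le> 1 / 128 \<longrightarrow> 0 < s' \<longrightarrow> s' \<le> 1 / 128 \<longrightarrow> (max R (3 * L))-lipschitz_on {0..1} f \<longrightarrow>
      (\<forall>y. 0 \<le> y \<longrightarrow> y \<le> 1 / 3 \<longrightarrow> f y = p + y *\<^sub>R V) \<longrightarrow>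
      (\<forall>y. 0 \<le> y \<longrightarrow> y \<le> 1 / 3 \<longrightarrow> f (1 - y) = p' + y *\<^sub>R V') \<longrightarrow>
      (\<exists>P. (\<forall>i. (\<lambda>u. P u $ i) holomorphic_on UNIV) \<and>
        P (of_real s) = p + s *\<^sub>R V \<and> P (of_real (1 - s')) = p' + s' *\<^sub>R V' \<and>
        (\<forall>u. norm u \<le> 1 / 128 \<longrightarrow> norm (P u - (p + u *s V)) \<le> \<delta> * (norm u)\<^sup>2) \<and>
        (\<forall>u. norm u \<le> 1 / 128 \<longrightarrow> norm (P (1 - u) - (p' + u *s V')) \<le> \<delta> * (norm u)\<^sup>2) \<and>
        (\<forall>u y. y \<in> {0..1} \<longrightarrow> dist u (of_real y) < \<eta> \<longrightarrow> dist (P u) (f y) < \<delta>))"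
    by (rule holomorphic_path[OF \<delta>(1), where R = R and L = "max R (3 * L)"])
  \<comment> \<open>The model disc is fixed before \<open>z\<close> and \<open>w\<close>, so its
    rate \<open>l\<close> is uniform; only the map \<open>P\<close> depends on the two
    points.\<close>
  obtain H l where l: "l > 0" and H: "H holomorphic_on ball 0 1" and
    Hz: "\<And>z. z \<in> ball 0 1 \<Longrightarrow>
        (norm (H z) \<le> ?s0 \<and> 0 < Re (H z) \<and> c2 * norm (H z) powr (1 + e) \<le> Re (H z)) \<or>
        (norm (1 - H z) \<le> ?s0 \<and> 0 < Re (1 - H z) \<and> c2 * norm (1 - H z) powr (1 + e) \<le> Re (1 - H z)) \<or>
        (\<exists>y\<in>{\<rho>..1 - \<rho>}. dist (H z) (of_real y) < \<eta>)" and
    Hs: "\<And>s. 0 < s \<Longrightarrow> s \<le> ?s0 \<Longrightarrow>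
        (\<exists>a::real. \<bar>a\<bar> < 1 \<and> H (of_real a) = of_real s \<and> l * s \<le> 1 - \<bar>a\<bar>) \<and>
        (\<exists>a::real. \<bar>a\<bar> < 1 \<and> H (of_real a) = of_real (1 - s) \<and> l * s \<le> 1 - \<bar>a\<bar>)"
    using model[OF \<eta>] by blast
  show ?thesis
  \<comment> \<open>Each point contributes \<open>1 - \<bar>a\<bar> \<ge> l * s \<ge> l * \<kappa>'
    * bdist D z\<close>; the factor 1/2 comes from \<open>lempert_le_real_points\<close>.\<close>
  proof (intro exI[of _ "(l * \<kappa>')\<^sup>2 / 2"] conjI ballI)
    show "(l * \<kappa>')\<^sup>2 / 2 > 0" using l \<kappa>' by simp
    fix z w assume z: "z \<in> D" and w: "w \<in> D"
    obtain p V s where zp: "z = p + s *\<^sub>R V" and s: "0 < s" "s \<le> ?s0" "\<kappa>' * bdist D z \<le> s"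
      and R: "norm p \<le> R" "norm V \<le> R" and
      g: "\<And>u q. norm u \<le> 1 \<Longrightarrow> norm q + c * \<kappa> * norm u powr (1 + e) < \<kappa> * Re u \<Longrightarrow> p + u *s V + q \<in> D"
      using germ[OF z] by blast
    obtain p' V' s' where wp: "w = p' + s' *\<^sub>R V'" and s': "0 < s'" "s' \<le> ?s0" "\<kappa>' * bdist D w \<le> s'"
      and R': "norm p' \<le> R" "norm V' \<le> R" and
      g': "\<And>u q. norm u \<le> 1 \<Longrightarrow> norm q + c * \<kappa> * norm u powr (1 + e) < \<kappa> * Re u \<Longrightarrow> p' + u *s V' + q \<in> D"
      using germ[OF w] by blast
    have b0: "ball (p + y *\<^sub>R V) (\<kappa> * y / 2) \<subseteq> D" if "0 < y" "y \<le> 1 / 3" for y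
      using that by (intro germ_ball[OF g e(1) c(1,2) \<kappa>]) auto
    have b1: "ball (p' + y *\<^sub>R V') (\<kappa> * y / 2) \<subseteq> D" if "0 < y" "y \<le> 1 / 3" for y
      using that by (intro germ_ball[OF g' e(1) c(1,2) \<kappa>]) auto
    obtain G :: "real \<Rightarrow> complex ^ 'n" where G: "L-lipschitz_on {0..1} G" "G 0 = p + (1 / 3) *\<^sub>R V"
      "G 1 = p' + (1 / 3) *\<^sub>R V'" "\<And>x. x \<in> {0..1} \<Longrightarrow> ball (G x) \<delta>p \<subseteq> D"
      using paths[rule_format, of "p + (1 / 3) *\<^sub>R V" "p' + (1 / 3) *\<^sub>R V'"] b0[of "1 / 3"] b1[of "1 / 3"]
      by auto
    obtain f where lf: "(max R (3 * L))-lipschitz_on {0..1} f"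
      and f0: "\<And>y. 0 \<le> y \<Longrightarrow> y \<le> 1 / 3 \<Longrightarrow> f y = p + y *\<^sub>R V"
      and f1: "\<And>y. 0 \<le> y \<Longrightarrow> y \<le> 1 / 3 \<Longrightarrow> f (1 - y) = p' + y *\<^sub>R V'"
      and fb: "\<And>y. \<rho> \<le> y \<Longrightarrow> y \<le> 1 - \<rho> \<Longrightarrow> ball (f y) (min (\<kappa> * \<rho> / 2) \<delta>p) \<subseteq> D"
      using joining_path[OF R(2) R'(2) \<rho> \<kappa> b0 b1 G] by blast
    obtain P where P_hol: "\<And>i. (\<lambda>u. P u $ i) holomorphic_on UNIV"
      and Ps: "P (of_real s) = z" "P (of_real (1 - s')) = w"
      and P0: "\<And>u. norm u \<le> ?s0 \<Longrightarrow> norm (P u - (p + u *s V)) \<le> \<delta> * (norm u)\<^sup>2"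
      and P1: "\<And>u. norm u \<le> ?s0 \<Longrightarrow> norm (P (1 - u) - (p' + u *s V')) \<le> \<delta> * (norm u)\<^sup>2"
      and Pf: "\<And>u y. y \<in> {0..1} \<Longrightarrow> dist u (of_real y) < \<eta> \<Longrightarrow> dist (P u) (f y) < \<delta>"
      using path[rule_format, OF R R' s(1,2) s'(1,2) lf f0 f1] unfolding zp wp by blast
    have in_D: "P (H \<zeta>) \<in> D" if \<zeta>: "\<zeta> \<in> ball 0 1" for \<zeta>
      using Hz[OF \<zeta>]
    proof (elim disjE bexE conjE)
      assume "norm (H \<zeta>) \<le> ?s0" "0 < Re (H \<zeta>)" "c2 * norm (H \<zeta>) powr (1 + e) \<le> Re (H \<zeta>)"
      then show ?thesis using P0[of "H \<zeta>"]
        by (intro germ_cusp[OF g e(1) e(4) c(3) c2 \<kappa> \<delta>(3), of "H \<zeta>"]) auto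
    next
      assume "norm (1 - H \<zeta>) \<le> ?s0" "0 < Re (1 - H \<zeta>)" "c2 * norm (1 - H \<zeta>) powr (1 + e) \<le> Re (1 - H \<zeta>)"
      then show ?thesis using P1[of "1 - H \<zeta>"]
        by (intro germ_cusp[OF g' e(1) e(4) c(3) c2 \<kappa> \<delta>(3), of "1 - H \<zeta>"]) auto
    next
      fix y assume y: "y \<in> {\<rho>..1 - \<rho>}" "dist (H \<zeta>) (of_real y) < \<eta>"
      then have "dist (P (H \<zeta>)) (f y) < \<delta>" using \<rho> by (intro Pf) auto
      then have "P (H \<zeta>) \<in> ball (f y) (min (\<kappa> * \<rho> / 2) \<delta>p)"
        using \<delta>(2) by (simp add: dist_commute)
      then show ?thesis using fb[of y] y(1) by auto
    qed
    have disc: "(\<lambda>\<zeta>. P (H \<zeta>)) \<in> hol_discs D"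
      unfolding hol_discs_def
    proof (intro CollectI conjI allI)
      fix i
      show "(\<lambda>\<zeta>. P (H \<zeta>) $ i) holomorphic_on ball 0 1"
        using holomorphic_on_compose_gen[OF H P_hol[of i]] by (simp add: comp_def)
    qed (use in_D in blast)
    obtain a :: real where a: "\<bar>a\<bar> < 1" "H (of_real a) = of_real s" "l * s \<le> 1 - \<bar>a\<bar>"
      using Hs[OF s(1,2)] by blast
    obtain b :: real where b: "\<bar>b\<bar> < 1" "H (of_real b) = of_real (1 - s')" "l * s' \<le> 1 - \<bar>b\<bar>"
      using Hs[OF s'(1,2)] by blast
    have bd: "0 \<le> bdist D x" for x by (simp add: bdist_def infdist_nonneg)
    have "l * (\<kappa>' * bdist D z) \<le> l * s" "l * (\<kappa>' * bdist D w) \<le> l * s'" using s s' l by auto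
    then have "l * (\<kappa>' * bdist D z) \<le> 1 - \<bar>a\<bar>" "l * (\<kappa>' * bdist D w) \<le> 1 - \<bar>b\<bar>"
      using a(3) b(3) by linarith+
    then have "(l * (\<kappa>' * bdist D z)) * (l * (\<kappa>' * bdist D w)) \<le> (1 - \<bar>a\<bar>) * (1 - \<bar>b\<bar>)"
      using a b l \<kappa>' bd by (intro mult_mono) auto
    moreover have "lempert D z w \<le> 1 - (1 - \<bar>a\<bar>) * (1 - \<bar>b\<bar>) / 2"
      by (rule lempert_le_real_points[OF disc a(1) _ b(1)]) (simp_all only: a b Ps)
    moreover have "(l * \<kappa>')\<^sup>2 / 2 * bdist D z * bdist D w =
        (l * (\<kappa>' * bdist D z)) * (l * (\<kappa>' * bdist D w)) / 2"
      by (simp add: power2_eq_square)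
    ultimately show "lempert D z w \<le> 1 - (l * \<kappa>')\<^sup>2 / 2 * bdist D z * bdist D w" by linarith
  qed
qed

end
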